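(* Let $p\in(1,2)\cup(2,\infty)$ and let $\varphi:\mathbb{R}^2\to\mathbb{R}$, $\varphi(x)=-|x|^2$. There exists a $2$-homogeneous function $u:\mathbb{R}^2\to\mathbb{R}$ which is a solution of the $p$-Laplacian obstacle problem $$\min\{-\Delta_p u,\;u-\varphi\}=0\qquad\text{in } \mathbb{R}^2,$$ and such that the set $\{u>\varphi\}$ is a cone with angle $$\theta_0=2\pi\left(1-\sqrt{\frac{p-1}{2p}}\right)\neq\pi .$$ In particular, the free boundary $\partial\{u>\varphi\}$ has a corner at the origin.
   Context: $\Delta_p u=\mathrm{div}(|\nabla u|^{p-2}\nabla u)$ is the $p$-Laplacian. A solution of $\min\{-\Delta_p u,u-\varphi\}=0$ in an open set $\Omega\subset\mathbb{R}^n$ is understood in the usual weak sense: $u$ is continuous, $u\in W^{1,p}_{\mathrm{loc}}(\Omega)$, $u\ge\varphi$ in $\Omega$, $-\Delta_p u\ge 0$ weakly in $\Omega$ (i.e. $\int_\Omega|\nabla u|^{p-2}\nabla u\cdot\nabla\zeta\,dx\ge0$ for all nonnegative $\zeta\in C^1_c(\Omega)$), and $\Delta_p u=0$ weakly in the open set $\{u>\varphi\}$. A function $u$ is $2$-homogeneous if $u(tx)=t^2u(x)$ for all $t>0$ and all $x$. In the plane, a cone with angle $\theta_0\in(0,2\pi)$ means a set which, up to a rotation about the origin, equals the open sector $\{re^{i\theta}: r>0,\ 0<\theta<\theta_0\}$ in polar coordinates. The free boundary is then the union of two rays from the origin meeting at angle $\theta_0$; "has a corner at the origin" means that $\theta_0\ne\pi$,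 so that these two rays do not form a straight line. *)

theory Defs
  imports "HOL-Analysis.Analysis"
begin

definition grad :: "('a::euclidean_space \<Rightarrow> real) \<Rightarrow> 'a \<Rightarrow> 'a" where
  "grad f x = (THE D. GDERIV f x :> D)"

(* Elements of C^1_c(\<Omega>) are represented by their extension by zero to the whole space. *)
definition C1c :: "'a::euclidean_space set \<Rightarrow> ('a \<Rightarrow> real) set" where
  "C1c \<Omega> = {\<zeta>. (\<forall>x. \<zeta> differentiable (at x)) \<and> continuous_on UNIV (grad \<zeta>) \<and>
      compact (closure (support_on UNIV \<zeta>)) \<and> closure (support_on UNIV \<zeta>) \<subseteq> \<Omega>}"

definition Lp_loc :: "real \<Rightarrow> 'a::euclidean_space set \<Rightarrow> ('a \<Rightarrow> 'b::euclidean_space) set" where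
  "Lp_loc p \<Omega> = {f. set_borel_measurable lebesgue \<Omega> f \<and>
      (\<forall>K. compact K \<longrightarrow> K \<subseteq> \<Omega> \<longrightarrow> set_integrable lebesgue K (\<lambda>x. norm (f x) powr p))}"

definition is_weak_grad ::
    "'a::euclidean_space set \<Rightarrow> ('a \<Rightarrow> real) \<Rightarrow> ('a \<Rightarrow> 'a) \<Rightarrow> bool" where
  "is_weak_grad \<Omega> u g \<longleftrightarrow> u \<in> Lp_loc 1 \<Omega> \<and> g \<in> Lp_loc 1 \<Omega> \<and>
      (\<forall>\<zeta>\<in>C1c \<Omega>. (LINT x:\<Omega>|lebesgue. u x *\<^sub>R grad \<zeta> x) = - (LINT x:\<Omega>|lebesgue. \<zeta> x *\<^sub>R g x))"

(* u lies in W^{1,p}_loc(\<Omega>) and g is a representative of its (a.e. unique) weak gradient. *)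
definition W1p_loc_grad ::
    "real \<Rightarrow> 'a::euclidean_space set \<Rightarrow> ('a \<Rightarrow> real) \<Rightarrow> ('a \<Rightarrow> 'a) \<Rightarrow> bool" where
  "W1p_loc_grad p \<Omega> u g \<longleftrightarrow> u \<in> Lp_loc p \<Omega> \<and> g \<in> Lp_loc p \<Omega> \<and> is_weak_grad \<Omega> u g"

definition W1p_loc :: "real \<Rightarrow> 'a::euclidean_space set \<Rightarrow> ('a \<Rightarrow> real) set" where
  "W1p_loc p \<Omega> = {u. \<exists>g. W1p_loc_grad p \<Omega> u g}"

(* At points where g vanishes the integrand is 0 for every p: the scalar factor is 0 powr (p - 2) = 0
   and the vector factor is 0. *)
definition p_energy_form ::
    "real \<Rightarrow> 'a::euclidean_space set \<Rightarrow> ('a \<Rightarrow> 'a) \<Rightarrow> ('a \<Rightarrow> real) \<Rightarrow> real" where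
  "p_energy_form p \<Omega> g \<zeta> =
     (LINT x:\<Omega>|lebesgue. ((norm (g x) powr (p - 2)) *\<^sub>R g x) \<bullet> grad \<zeta> x)"

definition weakly_p_superharmonic ::
    "real \<Rightarrow> 'a::euclidean_space set \<Rightarrow> ('a \<Rightarrow> real) \<Rightarrow> bool" where
  "weakly_p_superharmonic p \<Omega> u \<longleftrightarrow> (\<exists>g. W1p_loc_grad p \<Omega> u g \<and>
     (\<forall>\<zeta>\<in>C1c \<Omega>. (\<forall>x. 0 \<le> \<zeta> x) \<longrightarrow> 0 \<le> p_energy_form p \<Omega> g \<zeta>))"

definition weakly_p_harmonic ::
    "real \<Rightarrow> 'a::euclidean_space set \<Rightarrow> ('a \<Rightarrow> real) \<Rightarrow> bool" where
  "weakly_p_harmonic p \<Omega> u \<longleftrightarrow> (\<exists>g. W1p_loc_grad p \<Omega> u g \<and>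
     (\<forall>\<zeta>\<in>C1c \<Omega>. p_energy_form p \<Omega> g \<zeta> = 0))"

definition p_obstacle_solution ::
    "real \<Rightarrow> 'a::euclidean_space set \<Rightarrow> ('a \<Rightarrow> real) \<Rightarrow> ('a \<Rightarrow> real) \<Rightarrow> bool" where
  "p_obstacle_solution p \<Omega> \<phi> u \<longleftrightarrow>
     open \<Omega> \<and> continuous_on \<Omega> u \<and> u \<in> W1p_loc p \<Omega> \<and> (\<forall>x\<in>\<Omega>. \<phi> x \<le> u x) \<and>
     weakly_p_superharmonic p \<Omega> u \<and>
     open {x\<in>\<Omega>. \<phi> x < u x} \<and> weakly_p_harmonic p {x\<in>\<Omega>. \<phi> x < u x} u"

definition two_homogeneous :: "('a::real_vector \<Rightarrow> real) \<Rightarrow> bool" where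
  "two_homogeneous u \<longleftrightarrow> (\<forall>t>0. \<forall>x. u (t *\<^sub>R x) = t\<^sup>2 * u x)"

definition polar :: "real \<Rightarrow> real \<Rightarrow> real^2" where
  "polar r \<theta> = vector [r * cos \<theta>, r * sin \<theta>]"

definition sector :: "real \<Rightarrow> (real^2) set" where
  "sector \<theta>\<^sub>0 = {polar r \<theta> | r \<theta>. 0 < r \<and> 0 < \<theta> \<and> \<theta> < \<theta>\<^sub>0}"

definition ray :: "real \<Rightarrow> (real^2) set" where
  "ray \<theta> = {polar r \<theta> | r. 0 \<le> r}"

definition is_cone_with_angle :: "(real^2) set \<Rightarrow> real \<Rightarrow> bool" where
  "is_cone_with_angle S \<theta>\<^sub>0 \<longleftrightarrow> 0 < \<theta>\<^sub>0 \<and> \<theta>\<^sub>0 < 2 * pi \<and>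
     (\<exists>R :: real^2^2. rotation_matrix R \<and> S = (\<lambda>x. R *v x) ` sector \<theta>\<^sub>0)"

(* The two rays bound a cone with angle \<theta>\<^sub>0 and do not form a straight line. *)
definition has_corner_at_origin :: "(real^2) set \<Rightarrow> real \<Rightarrow> bool" where
  "has_corner_at_origin \<Gamma> \<theta>\<^sub>0 \<longleftrightarrow> 0 < \<theta>\<^sub>0 \<and> \<theta>\<^sub>0 < 2 * pi \<and> \<theta>\<^sub>0 \<noteq> pi \<and>
     (\<exists>R :: real^2^2. rotation_matrix R \<and> \<Gamma> = (\<lambda>x. R *v x) ` (ray 0 \<union> ray \<theta>\<^sub>0))"

end

theory Submission
  imports Defs
begin

text \<open>
  The solution is sought as \<open>u = r\<^sup>2 f(\<theta>)\<close>. Away from the origin such a function is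
  \<open>p\<close>-harmonic exactly when
  \<open>(Q\<^bsup>p-2\<^esup> f')' + 2 p Q\<^bsup>p-2\<^esup> f = 0\<close>, where \<open>Q = sqrt (4 f\<^sup>2 + f'\<^sup>2)\<close> is the length of the
  gradient on the unit circle. The equation becomes explicit in terms of the angle \<open>\<eta>\<close> from the
  gradient to the radius, that is \<open>2 f = Q cos \<eta>\<close> and \<open>f' = - Q sin \<eta>\<close>: with
  \<open>k = (p - 2) / p\<close> it reads
  \<open>\<eta>' = (1 + k sin\<^sup>2 \<eta>) / (1 / p + k sin\<^sup>2 \<eta>)\<close>, and \<open>Q\<close> is a multiple of
  \<open>sqrt (1 + k sin\<^sup>2 \<eta>)\<close>, the factor being \<open>2\<close> by the contact condition below.
  So \<open>f\<close> is an elementary function of \<open>\<eta>\<close>, and \<open>\<theta>\<close> is an elementary increasing function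
  \<open>\<Theta>\<close> of \<open>\<eta>\<close>.

  The obstacle has profile \<open>-1\<close>, and contact of first order, \<open>f = -1\<close> and \<open>f' = 0\<close>, means that
  \<open>sin \<eta> = 0\<close> and \<open>cos \<eta> = -1\<close>. The non-contact sector is therefore swept while \<open>\<eta>\<close> runs from
  \<open>-\<pi>\<close> to \<open>\<pi>\<close>, and its opening is \<open>2 \<Theta>(\<pi>) = 2 \<pi> (1 - c)\<close> with \<open>c = sqrt ((p - 1) / (2 p))\<close>. This
  differs from \<open>\<pi>\<close> because \<open>c = 1/2\<close> only for \<open>p = 2\<close>. Outside the sector \<open>u\<close> is continued by the
  obstacle.

  For the weak formulation, the flux of \<open>u\<close> has the components \<open>r\<^bsup>p-1\<^esup> A(\<theta>)\<close> and
  \<open>r\<^bsup>p-1\<^esup> B(\<theta>)\<close> along the radius and along the circle. Here \<open>B\<close> is continuous, \<open>B' = - p A\<close> in the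
  sector, and \<open>B' = 0\<close>, \<open>A < 0\<close> on the contact set. The lemma \<open>polar_divergence\<close> writes the
  energy form in polar coordinates and integrates by parts in \<open>r\<close> and in \<open>\<theta>\<close> separately, which gives
  \<open>- \<integral>\<integral> r\<^bsup>p-1\<^esup> (p A + B') \<zeta> dr d\<theta>\<close>: this vanishes for test functions supported in the sector and is
  nonnegative for nonnegative ones. The kinks of \<open>B\<close> do no harm, since a one-dimensional
  integration by parts tolerates finitely many of them. The same lemma, applied to the fields \<open>u e\<close>
  with constant \<open>e\<close>, identifies the weak gradient of \<open>u\<close>; thus \<open>u\<close> is never differentiated as a
  function on the plane, and neither the origin nor the cut of the polar angle needs a separate
  argument.
\<close>

section \<open>Polar coordinates in the plane\<close>

lemma vector2_eq: "(vector [x, y] :: real^2) = x *\<^sub>R axis 1 1 + y *\<^sub>R axis 2 1"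
  by (simp add: vec_eq_iff forall_2 axis_def)

lemma continuous_on_vector2 [continuous_intros]:
  fixes f g :: "'a::topological_space \<Rightarrow> real"
  assumes "continuous_on S f" "continuous_on S g"
  shows "continuous_on S (\<lambda>x. vector [f x, g x] :: real^2)"
  unfolding vector2_eq by (intro continuous_intros assms)

lemma Basis_vec2: "(Basis :: (real^2) set) = {axis 1 1, axis 2 1}"
  by (auto simp: Basis_vec_def UNIV_2)

lemma inner_vec2: "(x::real^2) \<bullet> y = x $ 1 * y $ 1 + x $ 2 * y $ 2"
  by (simp add: inner_vec_def sum_2)

lemma norm_vec2: "norm (x::real^2) = sqrt ((x $ 1)\<^sup>2 + (x $ 2)\<^sup>2)"
  by (simp add: norm_eq_sqrt_inner inner_vec2 power2_eq_square)

lemma measurable_vector2 [measurable]: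
  "(\<lambda>z. vector [fst z, snd z] :: real^2) \<in> borel_measurable (borel \<Otimes>\<^sub>M borel)"
  unfolding borel_prod by (intro borel_measurable_continuous_onI continuous_intros)

text \<open>
  Transfers Fubini's theorem, which is about product types, to \<open>real^2\<close>.
\<close>

lemma lborel_vec2_eq_distr:
  "distr (lborel \<Otimes>\<^sub>M lborel) borel (\<lambda>z. vector [fst z, snd z]) = (lborel :: (real^2) measure)"
proof (rule lborel_eqI[symmetric])
  fix l u :: "real^2"
  assume lu: "\<And>b. b \<in> Basis \<Longrightarrow> l \<bullet> b \<le> u \<bullet> b"
  then have le: "l $ 1 \<le> u $ 1" "l $ 2 \<le> u $ 2"
    using lu[of "axis 1 1"] lu[of "axis 2 1"] by (simp_all add: Basis_vec2 inner_axis)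
  have "(\<lambda>z. vector [fst z, snd z]) -` box l u \<inter> space (lborel \<Otimes>\<^sub>M lborel)
      = {l$1<..<u$1} \<times> {l$2<..<u$2}"
    by (auto simp: mem_box Basis_vec2 inner_axis space_pair_measure)
  moreover have "(\<Prod>b\<in>Basis. (u - l) \<bullet> b) = (u$1 - l$1) * (u$2 - l$2)"
    by (simp add: Basis_vec2 axis_eq_axis inner_axis)
  ultimately show "emeasure (distr (lborel \<Otimes>\<^sub>M lborel) borel (\<lambda>z. vector [fst z, snd z])) (box l u)
      = (\<Prod>b\<in>Basis. (u - l) \<bullet> b)"
    using le by (subst emeasure_distr) (auto simp: lborel.emeasure_pair_measure_Times ennreal_mult)
qed simp

lemma polar_nth [simp]: "polar r \<theta> $ 1 = r * cos \<theta>" "polar r \<theta> $ 2 = r * sin \<theta>"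
  by (simp_all add: polar_def)

lemma norm_polar [simp]: "norm (polar r \<theta>) = \<bar>r\<bar>"
proof -
  have "(r * cos \<theta>)\<^sup>2 + (r * sin \<theta>)\<^sup>2 = r\<^sup>2"
    using sin_cos_squared_add[of \<theta>] by algebra
  then show ?thesis by (simp add: norm_vec2)
qed

lemma ex_polar: "\<exists>\<theta>. -pi < \<theta> \<and> \<theta> \<le> pi \<and> x = polar (norm x) \<theta>"
proof (cases "x = 0")
  case True
  then show ?thesis by (intro exI[of _ 0]) (auto simp: vec_eq_iff forall_2)
next
  case False
  then have n: "norm x > 0" by simp
  have sq: "(norm x)\<^sup>2 = (x$1)\<^sup>2 + (x$2)\<^sup>2"
    by (simp add: norm_vec2)
  have "(x$1 / norm x)\<^sup>2 + (x$2 / norm x)\<^sup>2 = ((x$1)\<^sup>2 + (x$2)\<^sup>2) / (norm x)\<^sup>2"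
    by (simp add: power_divide add_divide_distrib)
  also have "\<dots> = 1"
    using n by (simp add: sq[symmetric])
  finally obtain t0 where t0: "x$1 / norm x = cos t0" "x$2 / norm x = sin t0"
    using sincos_total_2pi by metis
  obtain t where t: "-pi < t" "t \<le> pi" "sin t = sin t0" "cos t = cos t0"
    using sincos_principal_value by metis
  have "x$1 = norm x * cos t" "x$2 = norm x * sin t"
    unfolding t t0[symmetric] using n by simp_all
  then have "x = polar (norm x) t"
    unfolding vec_eq_iff forall_2 polar_nth by blast
  with t show ?thesis by blast
qed

lemma polar_inj:
  assumes "polar r s = polar r' t" "0 < r" "0 < r'" "-pi < s" "s \<le> pi" "-pi < t" "t \<le> pi"
  shows "r = r' \<and> s = t"
proof -
  have r: "r = r'" using arg_cong[OF assms(1), of norm] assms(2,3) by simp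
  have "polar r s $ 1 = polar r t $ 1" "polar r s $ 2 = polar r t $ 2"
    using assms(1) r by metis+
  then have "cos s = cos t" "sin s = sin t"
    using assms(2) by simp_all
  then obtain n :: int where n: "s = t + 2 * pi * n"
    using sin_cos_eq_iff[of s t] by auto
  have "\<bar>2 * pi * n\<bar> < 2 * pi * 1"
    using n assms by linarith
  then have "\<bar>real_of_int n\<bar> < 1"
    unfolding abs_mult by (simp add: abs_mult)
  then have "s = t"
    using n by simp
  with r show ?thesis ..
qed

lemma continuous_on_polar [continuous_intros]:
  fixes f g :: "'a::t2_space \<Rightarrow> real"
  assumes "continuous_on S f" "continuous_on S g"
  shows "continuous_on S (\<lambda>x. polar (f x) (g x))"
  unfolding polar_def by (intro continuous_intros assms)

lemma borel_measurable_polar [measurable (raw)]: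
  assumes [measurable]: "f \<in> borel_measurable M" "g \<in> borel_measurable M"
  shows "(\<lambda>x. polar (f x) (g x)) \<in> borel_measurable M"
  unfolding polar_def vector2_eq by measurable

lemma polar_shift_2pi: "polar r (\<theta> + 2 * pi) = polar r \<theta>"
  by (simp add: polar_def)

text \<open>
  The unit vector \<open>polar 1 (\<theta> + pi/2)\<close> is the direction of increasing angle. Together with \<open>polar 1 \<theta>\<close>
  it forms the moving frame in which all vector fields below are decomposed.
\<close>

lemma polar_rotate: "cos \<alpha> *\<^sub>R polar r \<theta> - sin \<alpha> *\<^sub>R polar r (\<theta> + pi/2) = polar r (\<theta> - \<alpha>)"
  by (simp add: vec_eq_iff forall_2 sin_add cos_add sin_diff cos_diff algebra_simps)

lemma polar_frame: "e = (e \<bullet> polar 1 \<theta>) *\<^sub>R polar 1 \<theta> + (e \<bullet> polar 1 (\<theta> + pi/2)) *\<^sub>R polar 1 (\<theta> + pi/2)"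
proof -
  have "(cos \<theta>)\<^sup>2 + (sin \<theta>)\<^sup>2 = 1" by simp
  then have "a = (a * cos \<theta> + b * sin \<theta>) * cos \<theta> + (b * cos \<theta> - a * sin \<theta>) * - sin \<theta>"
    "b = (a * cos \<theta> + b * sin \<theta>) * sin \<theta> + (b * cos \<theta> - a * sin \<theta>) * cos \<theta>" for a b
    by algebra+
  from this(1)[of "e $ 1" "e $ 2"] this(2)[of "e $ 2" "e $ 1"] show ?thesis
    by (simp add: vec_eq_iff forall_2 inner_vec2 sin_add cos_add)
qed

lemma polar_has_vector_derivative_radius:
  "((\<lambda>r. polar r \<theta>) has_vector_derivative polar 1 \<theta>) (at r within S)"
  unfolding has_vector_derivative_def polar_def vector2_eq
  by (auto intro!: derivative_eq_intros simp: scaleR_add_right)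

lemma polar_has_vector_derivative_angle:
  "((\<lambda>\<theta>. polar r \<theta>) has_vector_derivative polar r (\<theta> + pi / 2)) (at \<theta> within S)"
  unfolding has_vector_derivative_def polar_def vector2_eq
  by (auto intro!: derivative_eq_intros simp: scaleR_diff_right scaleR_add_right sin_add cos_add mult_ac)

lemma polar_normal_has_vector_derivative:
  "((\<lambda>\<theta>. polar 1 (\<theta> + pi/2)) has_vector_derivative - polar 1 \<theta>) (at \<theta>)"
proof -
  have "((\<lambda>\<theta>. \<theta> + pi/2) has_vector_derivative 1) (at \<theta>)"
    by (auto intro!: derivative_eq_intros)
  from vector_diff_chain_at[OF this polar_has_vector_derivative_angle[of 1]]
  have "((\<lambda>\<theta>. polar 1 (\<theta> + pi/2)) has_vector_derivative polar 1 (\<theta> + pi/2 + pi/2)) (at \<theta>)"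
    by (simp only: o_def scaleR_one)
  moreover have "polar 1 (\<theta> + pi/2 + pi/2) = - polar 1 \<theta>"
    by (simp add: vec_eq_iff forall_2)
  ultimately show ?thesis by (simp only:)
qed

text \<open>
  The change of variables theorem applied to \<open>(r, \<theta>) \<mapsto> polar r \<theta>\<close>, which is injective on the half strip
  with Jacobian \<open>r\<close> and misses only a subset of the horizontal axis.
\<close>

lemma integral_polar_vec:
  fixes h :: "real^2 \<Rightarrow> real"
  assumes h: "integrable lborel h"
  defines "S \<equiv> {v :: real^2. 0 < v$1 \<and> - pi < v$2 \<and> v$2 < pi}"
  shows "integrable lborel (\<lambda>v. indicator S v * (v$1 * h (polar (v$1) (v$2))))"
    and "(LINT v|lborel. indicator S v * (v$1 * h (polar (v$1) (v$2)))) = (LINT x|lborel. h x)"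
proof -
  have [measurable]: "h \<in> borel_measurable borel" using h by auto
  define G :: "real^2 \<Rightarrow> real^2" where "G v = polar (v$1) (v$2)" for v
  define G' :: "real^2 \<Rightarrow> real^2 \<Rightarrow> real^2" where
    "G' v d = vector [cos (v$2) * d$1 - v$1 * sin (v$2) * d$2,
                      sin (v$2) * d$1 + v$1 * cos (v$2) * d$2]" for v d
  have S_open: "open S"
    unfolding S_def by (intro open_Collect_conj open_Collect_less continuous_intros)
  have S_meas: "S \<in> sets borel" using S_open by simp
  have G_meas[measurable]: "G \<in> borel_measurable borel"
    unfolding G_def by (intro borel_measurable_continuous_onI continuous_intros)
  have nth: "((\<lambda>v::real^2. v $ i) has_derivative (\<lambda>d. d $ i)) (at v within S)" for i v
    by (rule bounded_linear.has_derivative[OF bounded_linear_vec_nth has_derivative_ident])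
  have der: "(G has_derivative G' v) (at v within S)" for v
  proof -
    have 1: "((\<lambda>v. v$1 * cos (v$2)) has_derivative
        (\<lambda>d. cos (v$2) * d$1 - v$1 * sin (v$2) * d$2)) (at v within S)"
      by (rule derivative_eq_intros nth refl)+ (simp add: fun_eq_iff)
    have 2: "((\<lambda>v. v$1 * sin (v$2)) has_derivative
        (\<lambda>d. sin (v$2) * d$1 + v$1 * cos (v$2) * d$2)) (at v within S)"
      by (rule derivative_eq_intros nth refl)+ (simp add: fun_eq_iff)
    show ?thesis
      unfolding G_def G'_def polar_def vector2_eq
      by (intro has_derivative_add has_derivative_scaleR_left 1 2)
  qed
  have det: "det (matrix (G' v)) = v$1" for v
  proof -
    have "det (matrix (G' v)) = v$1 * (cos (v$2))\<^sup>2 + v$1 * (sin (v$2))\<^sup>2"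
      by (simp add: det_2 matrix_def G'_def axis_def power2_eq_square algebra_simps)
    then show ?thesis using sin_cos_squared_add[of "v$2"] by algebra
  qed
  have inj: "inj_on G S"
  proof (rule inj_onI)
    fix v w assume "v \<in> S" "w \<in> S" "G v = G w"
    then show "v = w"
      using polar_inj[of "v$1" "v$2" "w$1" "w$2"] by (auto simp: S_def G_def vec_eq_iff forall_2)
  qed
  have img: "UNIV - G ` S \<subseteq> {x. axis 2 1 \<bullet> x = 0}"
  proof
    fix x assume x: "x \<in> UNIV - G ` S"
    obtain t where t: "-pi < t" "t \<le> pi" "x = polar (norm x) t" using ex_polar by blast
    have "x = 0 \<or> t = pi"
    proof (rule ccontr)
      assume "\<not> (x = 0 \<or> t = pi)"
      then have "vector [norm x, t] \<in> S" "G (vector [norm x, t]) = x"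
        using t by (auto simp: S_def G_def)
      with x show False by (metis DiffD2 imageI)
    qed
    then show "x \<in> {x :: real^2. axis 2 1 \<bullet> x = 0}"
    proof
      assume "t = pi"
      then have "polar (norm x) t $ 2 = 0" by simp
      then have "x $ 2 = 0" using t(3) by metis
      then show ?thesis by (simp add: inner_axis')
    qed simp
  qed
  have neg: "negligible (UNIV - G ` S)"
    by (rule negligible_subset[OF _ img]) (intro negligible_hyperplane, simp add: axis_eq_0_iff)
  have habs: "h absolutely_integrable_on UNIV"
    using h by (simp add: set_integrable_def integrable_completion)
  have I: "integral UNIV h = (LINT x|lborel. h x)"
    using h by (rule integral_lborel)
  have s1: "negligible {x \<in> UNIV - G ` S. h x \<noteq> 0}" "negligible {x \<in> G ` S - UNIV. h x \<noteq> 0}"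
    by (auto intro: negligible_subset[OF neg])
  have "h absolutely_integrable_on (G ` S)"
    using habs absolutely_integrable_spike_set_eq[OF s1] by simp
  moreover have "integral (G ` S) h = (LINT x|lborel. h x)"
    using integral_spike_set[OF s1] I by simp
  ultimately have "(\<lambda>x. vec (h x) :: real^1) absolutely_integrable_on (G ` S) \<and>
      integral (G ` S) (\<lambda>x. vec (h x)) = (vec (LINT x|lborel. h x) :: real^1)"
    by (auto simp: absolutely_integrable_on_1_iff integral_on_1_eq)
  then have "(\<lambda>v. \<bar>det (matrix (G' v))\<bar> *\<^sub>R vec (h (G v)) :: real^1) absolutely_integrable_on S \<and>
      integral S (\<lambda>v. \<bar>det (matrix (G' v))\<bar> *\<^sub>R vec (h (G v))) = (vec (LINT x|lborel. h x) :: real^1)"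
    using has_absolute_integral_change_of_variables[of S G G' "\<lambda>x. vec (h x) :: real^1"]
      S_meas der inj by auto
  then have A: "(\<lambda>v. \<bar>v$1\<bar> * h (G v)) absolutely_integrable_on S"
    and J: "integral S (\<lambda>v. \<bar>v$1\<bar> * h (G v)) = (LINT x|lborel. h x)"
    by (auto simp: det absolutely_integrable_on_1_iff integral_on_1_eq)
  have eq: "indicator S v * (\<bar>v$1\<bar> * h (G v)) = indicator S v * (v$1 * h (polar (v$1) (v$2)))" for v
    by (auto simp: S_def G_def indicator_def)
  have m: "(\<lambda>v. indicator S v * (\<bar>v$1\<bar> * h (G v))) \<in> borel_measurable borel"
    using S_meas by measurable
  have Ai: "set_integrable lborel S (\<lambda>v. \<bar>v$1\<bar> * h (G v))"
    using A m by (simp add: set_integrable_def integrable_completion)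
  then show "integrable lborel (\<lambda>v. indicator S v * (v$1 * h (polar (v$1) (v$2))))"
    by (simp add: set_integrable_def eq)
  have "(LINT v|lborel. indicator S v * (\<bar>v$1\<bar> * h (G v))) = integral S (\<lambda>v. \<bar>v$1\<bar> * h (G v))"
    using set_borel_integral_eq_integral(2)[OF Ai] by (simp add: set_lebesgue_integral_def)
  then show "(LINT v|lborel. indicator S v * (v$1 * h (polar (v$1) (v$2)))) = (LINT x|lborel. h x)"
    by (simp add: J eq)
qed

lemma integral_polar:
  fixes h :: "real^2 \<Rightarrow> real"
  assumes h: "integrable lborel h"
  shows "integrable (lborel \<Otimes>\<^sub>M lborel)
      (\<lambda>(r, \<theta>). indicator {0<..} r * indicator {-pi<..<pi} \<theta> * (r * h (polar r \<theta>)))"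
    and "(LINT (r, \<theta>)|(lborel \<Otimes>\<^sub>M lborel).
        indicator {0<..} r * indicator {-pi<..<pi} \<theta> * (r * h (polar r \<theta>))) = (LINT x|lborel. h x)"
proof -
  let ?S = "{v :: real^2. 0 < v$1 \<and> - pi < v$2 \<and> v$2 < pi}"
  let ?F = "\<lambda>v. indicator ?S v * (v$1 * h (polar (v$1) (v$2)))"
  let ?T = "\<lambda>z :: real \<times> real. vector [fst z, snd z] :: real^2"
  note i = integral_polar_vec[OF h]
  have m: "?F \<in> borel_measurable borel" using i(1) by auto
  have T: "?T \<in> lborel \<Otimes>\<^sub>M lborel \<rightarrow>\<^sub>M borel" by simp
  have eq: "(\<lambda>z. ?F (?T z)) =
     (\<lambda>(r, \<theta>). indicator {0<..} r * indicator {-pi<..<pi} \<theta> * (r * h (polar r \<theta>)))"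
    by (auto simp: fun_eq_iff indicator_def)
  show "integrable (lborel \<Otimes>\<^sub>M lborel)
      (\<lambda>(r, \<theta>). indicator {0<..} r * indicator {-pi<..<pi} \<theta> * (r * h (polar r \<theta>)))"
    using i(1) integrable_distr_eq[OF T m] by (simp only: lborel_vec2_eq_distr eq)
  show "(LINT (r, \<theta>)|(lborel \<Otimes>\<^sub>M lborel).
        indicator {0<..} r * indicator {-pi<..<pi} \<theta> * (r * h (polar r \<theta>))) = (LINT x|lborel. h x)"
    using i(2) integral_distr[OF T m] by (simp only: lborel_vec2_eq_distr eq)
qed

section \<open>Test functions\<close>

text \<open>
  As \<open>grad\<close> is a definite description, it has to be shown that a differentiable function has
  exactly one gradient vector. It is obtained from the derivative by taking the adjoint.
\<close>

lemma C1c_GDERIV: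
  assumes "\<zeta> \<in> C1c \<Omega>"
  shows "GDERIV \<zeta> x :> grad \<zeta> x"
proof -
  obtain D where D: "(\<zeta> has_derivative D) (at x)"
    using assms by (auto simp: C1c_def differentiable_def)
  have "D h = h \<bullet> adjoint D 1" for h
    using adjoint_works[OF has_derivative_linear[OF D], of h 1] by simp
  then have "D = (\<lambda>h. h \<bullet> adjoint D 1)" by (rule ext)
  then have ex: "GDERIV \<zeta> x :> adjoint D 1"
    using D unfolding gderiv_def by metis
  have "D1 = adjoint D 1" if "GDERIV \<zeta> x :> D1" for D1
  proof -
    have "(\<lambda>h. h \<bullet> D1) = (\<lambda>h. h \<bullet> adjoint D 1)"
      using that ex unfolding gderiv_def by (rule has_derivative_unique)
    then show ?thesis
      by (metis vector_eq_ldot)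
  qed
  with ex show ?thesis
    unfolding grad_def by (rule theI)
qed

lemma C1c_supportE:
  assumes "\<zeta> \<in> C1c \<Omega>"
  obtains K where "compact K" "K \<subseteq> \<Omega>" "\<And>x. x \<notin> K \<Longrightarrow> \<zeta> x = 0" "\<And>x. x \<notin> K \<Longrightarrow> grad \<zeta> x = 0"
proof
  let ?K = "closure (support_on UNIV \<zeta>)"
  show "compact ?K" "?K \<subseteq> \<Omega>" using assms by (auto simp: C1c_def)
  show z: "\<zeta> x = 0" if "x \<notin> ?K" for x
    using that closure_subset[of "support_on UNIV \<zeta>"] by (auto simp: support_on_def)
  show "grad \<zeta> x = 0" if "x \<notin> ?K" for x
  proof -
    have "(\<zeta> has_derivative (\<lambda>h. 0)) (at x)"
      by (rule has_derivative_transform_within_open[of "\<lambda>_. 0" _ _ _ "- ?K"]) (use that z in auto)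
    then have "(\<lambda>h. h \<bullet> grad \<zeta> x) = (\<lambda>h. 0)"
      using C1c_GDERIV[OF assms, of x] unfolding gderiv_def by (metis has_derivative_unique)
    then show ?thesis by (metis inner_eq_zero_iff)
  qed
qed

lemma C1c_continuous:
  assumes "\<zeta> \<in> C1c \<Omega>"
  shows "continuous_on S \<zeta>" "continuous_on S (grad \<zeta>)"
  using assms by (auto simp: C1c_def intro: continuous_on_subset continuous_at_imp_continuous_on
      differentiable_imp_continuous_within)

lemma C1c_measurable:
  assumes "\<zeta> \<in> C1c \<Omega>"
  shows "\<zeta> \<in> borel_measurable borel" "grad \<zeta> \<in> borel_measurable borel"
  using C1c_continuous[OF assms, of UNIV] by (auto intro: borel_measurable_continuous_onI)

lemma C1c_mono: "\<zeta> \<in> C1c \<Omega> \<Longrightarrow> \<Omega> \<subseteq> \<Omega>' \<Longrightarrow> \<zeta> \<in> C1c \<Omega>'"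
  by (auto simp: C1c_def)

lemma DERIV_C1c_comp:
  assumes "\<zeta> \<in> C1c \<Omega>" "(\<gamma> has_vector_derivative v) (at t)"
  shows "((\<lambda>t. \<zeta> (\<gamma> t)) has_real_derivative (v \<bullet> grad \<zeta> (\<gamma> t))) (at t)"
proof -
  have "((\<lambda>t. \<zeta> (\<gamma> t)) has_derivative (\<lambda>h. (h *\<^sub>R v) \<bullet> grad \<zeta> (\<gamma> t))) (at t)"
    by (rule has_derivative_compose[OF assms(2)[unfolded has_vector_derivative_def]
          C1c_GDERIV[OF assms(1), unfolded gderiv_def]])
  then show ?thesis
    by (rule has_derivative_imp_has_field_derivative) simp
qed

section \<open>Integration by parts in polar coordinates\<close>

lemma integrable_mult_bounded:
  fixes M f :: "'a \<Rightarrow> real"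
  assumes [measurable]: "M \<in> borel_measurable N" and M: "\<And>x. \<bar>M x\<bar> \<le> C" and f: "integrable N f"
  shows "integrable N (\<lambda>x. M x * f x)"
proof (rule Bochner_Integration.integrable_bound)
  have [measurable]: "f \<in> borel_measurable N" using f by auto
  show "integrable N (\<lambda>x. C * f x)" using f by simp
  show "(\<lambda>x. M x * f x) \<in> borel_measurable N" by measurable
  have "\<bar>M x\<bar> * \<bar>f x\<bar> \<le> \<bar>C\<bar> * \<bar>f x\<bar>" for x
    using M[of x] by (intro mult_right_mono) auto
  then show "AE x in N. norm (M x * f x) \<le> norm (C * f x)"
    by (intro AE_I2) (simp add: abs_mult)
qed

abbreviation polar_indicator :: "real \<Rightarrow> real \<Rightarrow> real" where
  "polar_indicator r \<theta> \<equiv> indicator {0<..} r * indicator {-pi<..<pi} \<theta>"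

text \<open>
  The form in which integrability is needed below: a function continuous up to the boundary of the strip,
  vanishing for large radius, times a merely bounded function of the angle such as the derivative of a
  function with kinks.
\<close>

lemma integrable_on_polar_strip:
  fixes g :: "real \<times> real \<Rightarrow> real" and M :: "real \<Rightarrow> real"
  assumes g: "continuous_on ({0..R} \<times> {-pi..pi}) g" and zero: "\<And>r \<theta>. r > R \<Longrightarrow> g (r, \<theta>) = 0"
    and [measurable]: "M \<in> borel_measurable borel" and M: "\<And>\<theta>. \<bar>M \<theta>\<bar> \<le> C"
  shows "integrable (lborel \<Otimes>\<^sub>M lborel) (\<lambda>(r, \<theta>). polar_indicator r \<theta> * (M \<theta> * g (r, \<theta>)))"
proof -
  let ?K = "{0..R} \<times> {-pi..pi}"
  let ?g = "\<lambda>z. indicator ?K z *\<^sub>R g z"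
  have i: "integrable (lborel \<Otimes>\<^sub>M lborel) ?g"
    unfolding lborel_prod using g by (intro borel_integrable_compact compact_Times) auto
  have [measurable]: "?g \<in> borel_measurable (borel \<Otimes>\<^sub>M borel)"
    using borel_measurable_integrable[OF i] by simp
  have "\<bar>polar_indicator r \<theta> * M \<theta>\<bar> \<le> C" for r \<theta>
    using M[of \<theta>] by (auto simp: indicator_def)
  then have "integrable (lborel \<Otimes>\<^sub>M lborel) (\<lambda>z. (polar_indicator (fst z) (snd z) * M (snd z)) * ?g z)"
    by (intro integrable_mult_bounded[OF _ _ i]) auto
  moreover have "polar_indicator r \<theta> * M \<theta> * ?g (r, \<theta>) = polar_indicator r \<theta> * (M \<theta> * g (r, \<theta>))" for r \<theta>
    by (cases "r \<le> R") (auto simp: indicator_def zero)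
  then have "(\<lambda>z. (polar_indicator (fst z) (snd z) * M (snd z)) * ?g z) = (\<lambda>(r, \<theta>). polar_indicator r \<theta> * (M \<theta> * g (r, \<theta>)))"
    by (intro ext) (simp only: split_paired_all fst_conv snd_conv split)
  ultimately show ?thesis by (simp only:)
qed

text \<open>
  The integrand is the derivative of \<open>r\<^bsup>q+1\<^esup> \<zeta>(polar r \<theta>)\<close>, which vanishes at \<open>r = 0\<close> and for large \<open>r\<close>. The
  power rule for real exponents is available for \<open>r > 0\<close>, whence the fundamental theorem in the version
  that asks for continuity at the end points and for the derivative in between.
\<close>

lemma radial_integral_eq_0:
  assumes \<zeta>: "\<zeta> \<in> C1c UNIV" and q: "0 < q"
  shows "(LINT r|lborel. indicator {0<..} r * (r powr (q + 1) * (polar 1 \<theta> \<bullet> grad \<zeta> (polar r \<theta>))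
      + (q + 1) * r powr q * \<zeta> (polar r \<theta>))) = 0"
proof -
  obtain K where K: "compact K" "\<And>x. x \<notin> K \<Longrightarrow> \<zeta> x = 0" "\<And>x. x \<notin> K \<Longrightarrow> grad \<zeta> x = 0"
    using C1c_supportE[OF \<zeta>] by metis
  obtain R where R: "0 < R" "\<And>x. x \<in> K \<Longrightarrow> norm x < R"
    using bounded_pos_less[of K] compact_imp_bounded[OF K(1)] by metis
  have far: "\<zeta> (polar r \<theta>) = 0" "grad \<zeta> (polar r \<theta>) = 0" if "r \<ge> R" for r
    using K R(2)[of "polar r \<theta>"] that by fastforce+
  let ?f = "\<lambda>r. r powr (q + 1) * (polar 1 \<theta> \<bullet> grad \<zeta> (polar r \<theta>)) + (q + 1) * r powr q * \<zeta> (polar r \<theta>)"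
  let ?F = "\<lambda>r. r powr (q + 1) * \<zeta> (polar r \<theta>)"
  note cont = continuous_on_compose2[OF C1c_continuous(1)[OF \<zeta>, of UNIV]]
    continuous_on_compose2[OF C1c_continuous(2)[OF \<zeta>, of UNIV]]
  have cf: "continuous_on {0..R} ?f"
    using q by (intro continuous_intros cont continuous_on_powr') auto
  have "(?f has_integral (?F R - ?F 0)) {0..R}"
  proof (rule fundamental_theorem_of_calculus_interior)
    show "continuous_on {0..R} ?F"
      using q by (intro continuous_intros cont continuous_on_powr') auto
    fix r assume r: "r \<in> {0<..<R}"
    have "(?F has_real_derivative ?f r) (at r)"
      using r by (auto intro!: derivative_eq_intros
          DERIV_C1c_comp[OF \<zeta> polar_has_vector_derivative_radius] simp: algebra_simps)
    then show "(?F has_vector_derivative ?f r) (at r)"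
      by (rule has_real_derivative_iff_has_vector_derivative[THEN iffD1])
  qed (use R in simp)
  then have I: "integral {0..R} ?f = 0"
    using far[of R] q by (simp add: integral_unique)
  have "(LINT r:{0..R}|lborel. ?f r) = integral {0..R} ?f"
    by (intro set_borel_integral_eq_integral(2) borel_integrable_atLeastAtMost' cf)
  moreover have "(LINT r|lborel. indicator {0<..} r * ?f r) = (LINT r:{0..R}|lborel. ?f r)"
    unfolding set_lebesgue_integral_def
    by (intro Bochner_Integration.integral_cong refl) (auto simp: indicator_def far)
  ultimately show ?thesis
    using I by simp
qed

text \<open>
  The integrand is the derivative of \<open>B(\<theta>) \<zeta>(polar r \<theta>)\<close> outside the finite set of kinks, and this function
  takes the same value at both ends of the interval.
\<close>

lemma angular_integral_eq_0:
  assumes \<zeta>: "\<zeta> \<in> C1c UNIV" 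
    and B: "continuous_on {-pi..pi} B" "B (-pi) = B pi"
    and B': "finite X" "\<And>\<theta>. \<theta> \<in> {-pi<..<pi} - X \<Longrightarrow> (B has_real_derivative D \<theta>) (at \<theta>)"
    and [measurable]: "D \<in> borel_measurable borel" and D: "\<And>\<theta>. \<bar>D \<theta>\<bar> \<le> C"
  shows "(LINT \<theta>|lborel. indicator {-pi<..<pi} \<theta> * (B \<theta> * (polar r (\<theta> + pi/2) \<bullet> grad \<zeta> (polar r \<theta>))
      + D \<theta> * \<zeta> (polar r \<theta>))) = 0"
proof -
  let ?f = "\<lambda>\<theta>. B \<theta> * (polar r (\<theta> + pi/2) \<bullet> grad \<zeta> (polar r \<theta>)) + D \<theta> * \<zeta> (polar r \<theta>)"
  let ?F = "\<lambda>\<theta>. B \<theta> * \<zeta> (polar r \<theta>)"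
  note cont = continuous_on_compose2[OF C1c_continuous(1)[OF \<zeta>, of UNIV]]
    continuous_on_compose2[OF C1c_continuous(2)[OF \<zeta>, of UNIV]]
  have "(?f has_integral (?F pi - ?F (-pi))) {-pi..pi}"
  proof (rule fundamental_theorem_of_calculus_interior_strong[OF B'(1)])
    show "continuous_on {-pi..pi} ?F"
      by (intro continuous_intros cont B) auto
    fix \<theta> assume t: "\<theta> \<in> {-pi<..<pi} - X"
    have "(?F has_real_derivative ?f \<theta>) (at \<theta>)"
      by (auto intro!: derivative_eq_intros B'(2)[OF t]
          DERIV_C1c_comp[OF \<zeta> polar_has_vector_derivative_angle] simp: algebra_simps)
    then show "(?F has_vector_derivative ?f \<theta>) (at \<theta>)"
      by (rule has_real_derivative_iff_has_vector_derivative[THEN iffD1])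
  qed simp
  moreover have "polar r (-pi) = polar r pi"
    using polar_shift_2pi[of r "-pi"] by simp
  ultimately have "integral {-pi..pi} ?f = 0"
    using B(2) by (simp add: integral_unique)
  then have I: "integral {-pi<..<pi} ?f = 0"
    using integral_open_interval[of "-pi" pi ?f] by (simp only: box_real)
  have i1: "set_integrable lborel {-pi..pi} (\<lambda>\<theta>. B \<theta> * (polar r (\<theta> + pi/2) \<bullet> grad \<zeta> (polar r \<theta>)))"
    by (intro borel_integrable_atLeastAtMost' continuous_intros B cont) auto
  have i2: "set_integrable lborel {-pi..pi} (\<lambda>\<theta>. \<zeta> (polar r \<theta>))"
    by (intro borel_integrable_atLeastAtMost' continuous_intros cont) auto
  have [measurable]: "\<zeta> \<in> borel_measurable borel" by (rule C1c_measurable[OF \<zeta>])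
  have i3: "set_integrable lborel {-pi..pi} (\<lambda>\<theta>. D \<theta> * \<zeta> (polar r \<theta>))"
    unfolding set_integrable_def
    using integrable_mult_bounded[OF _ D i2[unfolded set_integrable_def]] by (simp add: mult_ac)
  have "set_integrable lborel {-pi<..<pi} ?f"
    by (rule set_integrable_subset[OF set_integral_add(1)[OF i1 i3]]) auto
  from set_borel_integral_eq_integral(2)[OF this] I show ?thesis
    by (simp add: set_lebesgue_integral_def)
qed

text \<open>
  The field \<open>W\<close> is homogeneous of degree \<open>q\<close>. In classical terms its divergence is
  \<open>r\<^bsup>q-1\<^esup> ((q + 1) A + B')\<close>, and the Jacobian \<open>r\<close> turns this into the right-hand side. The singularity of
  the divergence at the origin, present for \<open>q < 1\<close>, is thereby absorbed.
\<close>

lemma polar_divergence: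
  assumes \<zeta>: "\<zeta> \<in> C1c UNIV" and q: "0 < q"
    and W: "\<And>r \<theta>. 0 < r \<Longrightarrow> -pi < \<theta> \<Longrightarrow> \<theta> < pi \<Longrightarrow>
        W (polar r \<theta>) = r powr q *\<^sub>R (A \<theta> *\<^sub>R polar 1 \<theta> + B \<theta> *\<^sub>R polar 1 (\<theta> + pi/2))"
    and W_int: "integrable lborel (\<lambda>x. W x \<bullet> grad \<zeta> x)"
    and A: "continuous_on {-pi..pi} A"
    and B: "continuous_on {-pi..pi} B" "B (-pi) = B pi"
    and B': "finite X" "\<And>\<theta>. \<theta> \<in> {-pi<..<pi} - X \<Longrightarrow> (B has_real_derivative D \<theta>) (at \<theta>)"
    and D: "D \<in> borel_measurable borel" "\<And>\<theta>. \<bar>D \<theta>\<bar> \<le> C"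
  shows "(LINT x|lborel. W x \<bullet> grad \<zeta> x) = - (LINT (r, \<theta>)|(lborel \<Otimes>\<^sub>M lborel).
      polar_indicator r \<theta> * (r powr q * ((q + 1) * A \<theta> + D \<theta>) * \<zeta> (polar r \<theta>)))"
proof -
  obtain K where K: "compact K" "\<And>x. x \<notin> K \<Longrightarrow> \<zeta> x = 0" "\<And>x. x \<notin> K \<Longrightarrow> grad \<zeta> x = 0"
    using C1c_supportE[OF \<zeta>] by metis
  obtain R where R: "0 < R" "\<And>x. x \<in> K \<Longrightarrow> norm x < R"
    using bounded_pos_less[of K] compact_imp_bounded[OF K(1)] by metis
  have far: "\<zeta> (polar r \<theta>) = 0" "grad \<zeta> (polar r \<theta>) = 0" if "r > R" for r \<theta>
    using K R(2)[of "polar r \<theta>"] that by fastforce+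
  let ?L = "lborel \<Otimes>\<^sub>M lborel :: (real \<times> real) measure"
  note cont = continuous_on_compose2[OF C1c_continuous(1)[OF \<zeta>, of UNIV]]
    continuous_on_compose2[OF C1c_continuous(2)[OF \<zeta>, of UNIV]]
    continuous_on_compose2[OF A] continuous_on_compose2[OF B(1)]
  \<comment> \<open>the radial term with its correction, the angular term, and the correction of the angular term\<close>
  define g1 where "g1 = (\<lambda>z. A (snd z) * (fst z powr (q+1) * (polar 1 (snd z) \<bullet> grad \<zeta> (polar (fst z) (snd z)))
      + (q+1) * fst z powr q * \<zeta> (polar (fst z) (snd z))))"
  define g2 where "g2 = (\<lambda>z. fst z powr q * (B (snd z) *
      (polar (fst z) (snd z + pi/2) \<bullet> grad \<zeta> (polar (fst z) (snd z)))))"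
  define g3 where "g3 = (\<lambda>z. fst z powr q * \<zeta> (polar (fst z) (snd z)))"
  define F1 where "F1 = (\<lambda>(r, \<theta>). polar_indicator r \<theta> * (1 * g1 (r, \<theta>)))"
  define F2 where "F2 = (\<lambda>(r, \<theta>). polar_indicator r \<theta> * (1 * g2 (r, \<theta>)))"
  define F3 where "F3 = (\<lambda>(r, \<theta>). polar_indicator r \<theta> * (D \<theta> * g3 (r, \<theta>)))"
  define H where "H = (\<lambda>(r, \<theta>). polar_indicator r \<theta> * (r * (W (polar r \<theta>) \<bullet> grad \<zeta> (polar r \<theta>))))"
  have q1: "0 < q + 1" using q by simp
  have i1: "integrable ?L F1" unfolding F1_def
    by (rule integrable_on_polar_strip[where R = R and C = 1])
      (auto simp: g1_def far intro!: continuous_intros cont continuous_on_powr' simp: q q1)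
  have i2: "integrable ?L F2" unfolding F2_def
    by (rule integrable_on_polar_strip[where R = R and C = 1])
      (auto simp: g2_def far intro!: continuous_intros cont continuous_on_powr' simp: q)
  have i3: "integrable ?L F3" unfolding F3_def
    by (rule integrable_on_polar_strip[where R = R and C = C])
      (auto simp: g3_def far intro!: continuous_intros cont continuous_on_powr' simp: q D)
  have iH: "integrable ?L H" and H: "(LINT z|?L. H z) = (LINT x|lborel. W x \<bullet> grad \<zeta> x)"
    unfolding H_def by (rule integral_polar[OF W_int])+
  have I1: "(LINT z|?L. F1 z) = 0"
  proof -
    have "(LINT z|?L. F1 z) = (LINT \<theta>|lborel. LINT r|lborel. F1 (r, \<theta>))"
      using lborel_pair.integral_snd[of "curry F1"] i1 by simp
    also have "\<dots> = (LINT \<theta>|lborel. LINT r|lborel. indicator {-pi<..<pi} \<theta> * A \<theta> *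
       (indicator {0<..} r * (r powr (q + 1) * (polar 1 \<theta> \<bullet> grad \<zeta> (polar r \<theta>))
      + (q + 1) * r powr q * \<zeta> (polar r \<theta>))))"
      by (intro Bochner_Integration.integral_cong refl) (simp add: F1_def g1_def)
    also have "\<dots> = 0"
      by (simp only: integral_mult_right_zero radial_integral_eq_0[OF \<zeta> q]) simp
    finally show ?thesis .
  qed
  have I23: "(LINT z|?L. F2 z + F3 z) = 0"
  proof -
    have "(LINT z|?L. F2 z + F3 z) = (LINT r|lborel. LINT \<theta>|lborel. F2 (r, \<theta>) + F3 (r, \<theta>))"
      using lborel_pair.integral_fst'[of "\<lambda>z. F2 z + F3 z"] i2 i3 by simp
    also have "\<dots> = (LINT r|lborel. LINT \<theta>|lborel. indicator {0<..} r * r powr q *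
       (indicator {-pi<..<pi} \<theta> * (B \<theta> * (polar r (\<theta> + pi/2) \<bullet> grad \<zeta> (polar r \<theta>))
      + D \<theta> * \<zeta> (polar r \<theta>))))"
      by (intro Bochner_Integration.integral_cong refl)
        (simp add: F2_def F3_def g2_def g3_def algebra_simps)
    also have "\<dots> = 0"
      by (simp only: integral_mult_right_zero angular_integral_eq_0[OF \<zeta> B B' D]) simp
    finally show ?thesis .
  qed
  \<comment> \<open>the two corrections are what remains of the complete derivatives once the flux \<open>H\<close> is removed\<close>
  have eq: "polar_indicator r \<theta> * (r powr q * ((q + 1) * A \<theta> + D \<theta>) * \<zeta> (polar r \<theta>)) =
      F1 (r, \<theta>) + (F2 (r, \<theta>) + F3 (r, \<theta>)) - H (r, \<theta>)" for r \<theta>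
  proof (cases "0 < r \<and> -pi < \<theta> \<and> \<theta> < pi")
    case True
    have "polar r (\<theta> + pi/2) = r *\<^sub>R polar 1 (\<theta> + pi/2)"
      by (simp add: vec_eq_iff forall_2)
    with True show ?thesis
      by (simp add: F1_def F2_def F3_def H_def g1_def g2_def g3_def W powr_add inner_add_left algebra_simps)
  qed (auto simp: F1_def F2_def F3_def H_def)
  have "(LINT (r, \<theta>)|?L. polar_indicator r \<theta> * (r powr q * ((q + 1) * A \<theta> + D \<theta>) * \<zeta> (polar r \<theta>)))
      = (LINT z|?L. F1 z + (F2 z + F3 z) - H z)"
    by (intro Bochner_Integration.integral_cong refl) (auto simp: eq)
  also have "\<dots> = - (LINT x|lborel. W x \<bullet> grad \<zeta> x)"
    using i1 i2 i3 iH I1 I23 by (simp add: H)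
  finally show ?thesis by simp
qed

section \<open>The angular profile\<close>

locale corner_profile =
  fixes p :: real
  assumes p_gt_1: "1 < p"
begin

definition c :: real where "c = sqrt ((p - 1) / (2 * p))"

text \<open>
  The phase equation depends on \<open>p\<close> through this number alone, as \<open>1 / p = (1 - k) / 2\<close>.
\<close>

definition k :: real where "k = (p - 2) / p"

text \<open>
  Half the opening of the sector on which the solution lies above the obstacle.
\<close>

definition \<beta> :: real where "\<beta> = pi * (1 - c)"

lemma c_pos: "0 < c" and c_sq: "2 * c\<^sup>2 = (p - 1) / p" and c_less_1: "c < 1"
proof -
  show "0 < c" using p_gt_1 by (simp add: c_def)
  have "c\<^sup>2 = (p - 1) / (2 * p)"
    unfolding c_def using p_gt_1 by (subst real_sqrt_pow2) auto
  then show "2 * c\<^sup>2 = (p - 1) / p" using p_gt_1 by (simp add: field_simps)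
  have "(p - 1) / (2 * p) < 1"
    using p_gt_1 by (simp add: field_simps)
  then show "c < 1"
    unfolding c_def by simp
qed

lemma k_eq: "k = 4 * c\<^sup>2 - 1" "1 / p = (1 - k) / 2"
  using c_sq p_gt_1 by (simp_all add: k_def field_simps)

lemma k_bounds: "-1 < k" "k < 1"
  using p_gt_1 by (simp_all add: k_def field_simps)

lemma \<beta>_bounds: "0 < \<beta>" "\<beta> < pi"
  using c_pos c_less_1 by (simp_all add: \<beta>_def)

text \<open>
  As functions of the phase \<open>\<psi>\<close>, the squared length of the gradient on the unit circle is \<open>4 w\<close>, and the
  phase moves at speed \<open>w / v\<close> with respect to the polar angle.
\<close>

definition w :: "real \<Rightarrow> real" where "w \<psi> = 1 + k * (sin \<psi>)\<^sup>2"

definition v :: "real \<Rightarrow> real" where "v \<psi> = 1 / p + k * (sin \<psi>)\<^sup>2"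

lemma sin_sq_bounds: "0 \<le> (sin \<psi>)\<^sup>2" "(sin \<psi>)\<^sup>2 \<le> (1::real)"
  using sin_cos_squared_add[of \<psi>] zero_le_power2[of "cos \<psi>"] by (simp, linarith)

lemma w_pos: "0 < w \<psi>"
proof -
  \<comment> \<open>a convex combination of \<open>1\<close> and \<open>1 + k\<close>\<close>
  have "w \<psi> = (1 - (sin \<psi>)\<^sup>2) + (1 + k) * (sin \<psi>)\<^sup>2"
    by (simp add: w_def algebra_simps)
  moreover have "0 \<le> (1 + k) * (sin \<psi>)\<^sup>2" "0 < (1 + k) * (sin \<psi>)\<^sup>2 \<or> (sin \<psi>)\<^sup>2 = 0"
    using k_bounds by auto
  ultimately show ?thesis
    using sin_sq_bounds[of \<psi>] by linarith
qed

lemma v_pos: "0 < v \<psi>"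
proof -
  \<comment> \<open>a convex combination of \<open>1 / p\<close> and \<open>(1 + k) / 2\<close>\<close>
  have "v \<psi> = (1 / p) * (1 - (sin \<psi>)\<^sup>2) + ((1 + k) / 2) * (sin \<psi>)\<^sup>2"
    unfolding v_def k_eq(2) by (simp add: field_simps)
  moreover have "0 \<le> ((1 + k) / 2) * (sin \<psi>)\<^sup>2" "0 < ((1 + k) / 2) * (sin \<psi>)\<^sup>2 \<or> (sin \<psi>)\<^sup>2 = 0"
    using k_bounds by auto
  moreover have "0 \<le> (1 / p) * (1 - (sin \<psi>)\<^sup>2)"
    using p_gt_1 sin_sq_bounds[of \<psi>] by (intro mult_nonneg_nonneg) auto
  moreover have "0 < (1 / p) * (1 - (sin \<psi>)\<^sup>2)" if "(sin \<psi>)\<^sup>2 = 0"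
    using that p_gt_1 by simp
  ultimately show ?thesis by linarith
qed

text \<open>
  The antiderivative of \<open>v / w\<close>. Since \<open>v / w = 1 - 2 c\<^sup>2 / w\<close> and \<open>w = cos\<^sup>2 + 4 c\<^sup>2 sin\<^sup>2\<close>, the usual
  antiderivative involves \<open>arctan (2 c tan \<psi>)\<close>, which jumps at odd multiples of \<open>pi / 2\<close>. Subtracting \<open>\<psi>\<close>
  inside, by the addition theorem of the tangent, removes the jumps and gives the expression below.
\<close>

definition \<Theta> :: "real \<Rightarrow> real" where
  "\<Theta> \<psi> = \<psi> - c * (\<psi> + arctan ((2 * c - 1) * sin \<psi> * cos \<psi> / ((cos \<psi>)\<^sup>2 + 2 * c * (sin \<psi>)\<^sup>2)))"

lemma \<Theta>_deriv: "(\<Theta> has_real_derivative v \<psi> / w \<psi>) (at \<psi>)"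
proof -
  define s where "s = sin \<psi>"
  define t where "t = cos \<psi>"
  have st: "s\<^sup>2 + t\<^sup>2 = 1" unfolding s_def t_def by simp
  define N where "N = (2 * c - 1) * s * t"
  define M where "M = t\<^sup>2 + 2 * c * s\<^sup>2"
  define N' where "N' = (2 * c - 1) * (t\<^sup>2 - s\<^sup>2)"
  define M' where "M' = 2 * (2 * c - 1) * s * t"
  have M: "M > 0"
  proof (cases "s = 0")
    case True
    then show ?thesis using st by (simp add: M_def)
  next
    case False
    then have "0 < 2 * c * s\<^sup>2" using c_pos by simp
    then show ?thesis unfolding M_def by (simp add: add_nonneg_pos)
  qed
  have w: "w \<psi> = t\<^sup>2 + 4 * c\<^sup>2 * s\<^sup>2"
    using st unfolding w_def k_eq(1) s_def[symmetric] by algebra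
  \<comment> \<open>the denominator of the derivative of \<open>arctan (N / M)\<close>; it factors as \<open>(t\<^sup>2 + s\<^sup>2) (t\<^sup>2 + 4 c\<^sup>2 s\<^sup>2)\<close>\<close>
  have E1: "M\<^sup>2 + N\<^sup>2 = w \<psi>"
    unfolding w M_def N_def using st by algebra
  have E2: "N' * M - N * M' + w \<psi> = 2 * c"
    unfolding w M_def N_def M'_def N'_def using st by algebra
  have dN: "((\<lambda>\<psi>. (2 * c - 1) * sin \<psi> * cos \<psi>) has_real_derivative N') (at \<psi>)"
    by (auto intro!: derivative_eq_intros simp: N'_def s_def t_def power2_eq_square algebra_simps)
  have dM: "((\<lambda>\<psi>. (cos \<psi>)\<^sup>2 + 2 * c * (sin \<psi>)\<^sup>2) has_real_derivative M') (at \<psi>)"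
    by (auto intro!: derivative_eq_intros simp: M'_def s_def t_def power2_eq_square algebra_simps)
  have dq: "((\<lambda>\<psi>. (2 * c - 1) * sin \<psi> * cos \<psi> / ((cos \<psi>)\<^sup>2 + 2 * c * (sin \<psi>)\<^sup>2))
      has_real_derivative (N' * M - N * M') / (M * M)) (at \<psi>)"
    using DERIV_divide[OF dN dM] M unfolding M_def N_def s_def t_def by simp
  have "(\<Theta> has_real_derivative 1 - c * (1 + inverse (1 + (N / M)\<^sup>2) * ((N' * M - N * M') / (M * M)))) (at \<psi>)"
    unfolding \<Theta>_def
    by (rule derivative_eq_intros DERIV_chain2[OF DERIV_arctan dq] refl)+
      (simp add: N_def M_def s_def t_def)
  moreover have "inverse (1 + (N / M)\<^sup>2) * ((N' * M - N * M') / (M * M)) = (N' * M - N * M') / (M\<^sup>2 + N\<^sup>2)"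
  proof -
    have "1 + (N / M)\<^sup>2 = (M\<^sup>2 + N\<^sup>2) / (M * M)"
      using M by (simp add: field_simps power2_eq_square)
    then show ?thesis using M by simp
  qed
  moreover have "1 - c * (1 + (N' * M - N * M') / (M\<^sup>2 + N\<^sup>2)) = (w \<psi> - 2 * c\<^sup>2) / w \<psi>"
  proof -
    have "N' * M - N * M' = 2 * c - w \<psi>" using E2 by simp
    then show ?thesis
      unfolding E1 using w_pos[of \<psi>] by (simp add: field_simps power2_eq_square)
  qed
  moreover have "w \<psi> - 2 * c\<^sup>2 = v \<psi>"
    unfolding c_sq w_def v_def using p_gt_1 by (simp add: field_simps)
  ultimately show ?thesis by simp
qed

lemma \<Theta>_strict_mono: "\<Theta> x < \<Theta> y \<longleftrightarrow> x < y"
proof -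
  have *: "\<Theta> x < \<Theta> y" if "x < y" for x y
    using DERIV_pos_imp_increasing[OF that, of \<Theta>] \<Theta>_deriv v_pos w_pos by (metis divide_pos_pos)
  then show ?thesis by (metis linorder_neqE order_less_asym)
qed

lemma inj_\<Theta>: "inj \<Theta>"
  by (rule injI) (metis \<Theta>_strict_mono linorder_neqE order_less_irrefl)

lemma \<Theta>_minus: "\<Theta> (- x) = - \<Theta> x"
proof -
  have eq: "arctan ((2 * c - 1) * sin (- x) * cos (- x) / ((cos (- x))\<^sup>2 + 2 * c * (sin (- x))\<^sup>2))
      = - arctan ((2 * c - 1) * sin x * cos x / ((cos x)\<^sup>2 + 2 * c * (sin x)\<^sup>2))"
    by (simp add: arctan_minus)
  show ?thesis
    unfolding \<Theta>_def eq by (simp add: algebra_simps)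
qed

lemma \<Theta>_pi: "\<Theta> pi = \<beta>"
  by (simp add: \<Theta>_def \<beta>_def algebra_simps)

lemma continuous_on_\<Theta>: "continuous_on S \<Theta>"
  using \<Theta>_deriv by (meson DERIV_isCont continuous_at_imp_continuous_on)

lemma \<Theta>_image: "\<Theta> ` {-pi..pi} = {-\<beta>..\<beta>}"
proof
  show "\<Theta> ` {-pi..pi} \<subseteq> {-\<beta>..\<beta>}"
    using \<Theta>_strict_mono \<Theta>_pi \<Theta>_minus[of pi] by (force simp: not_less[symmetric])
  show "{-\<beta>..\<beta>} \<subseteq> \<Theta> ` {-pi..pi}"
    using IVT'[of \<Theta> "-pi" _ pi] \<Theta>_pi \<Theta>_minus[of pi] continuous_on_\<Theta> by force
qed

text \<open>
  The phase as a function of the polar angle. Clamping the angle to \<open>[-\<beta>, \<beta>]\<close> freezes the phase at \<open>\<plusminus>pi\<close>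
  on the contact set, so that the formulas for the profile below hold for all angles.
\<close>

definition \<eta> :: "real \<Rightarrow> real" where "\<eta> \<theta> = inv \<Theta> (max (- \<beta>) (min \<beta> \<theta>))"

lemma inv_\<Theta>: "inv \<Theta> (\<Theta> x) = x"
  using inj_\<Theta> by simp

lemma \<eta>_inside: "\<bar>\<theta>\<bar> \<le> \<beta> \<Longrightarrow> \<Theta> (\<eta> \<theta>) = \<theta>"
proof -
  assume "\<bar>\<theta>\<bar> \<le> \<beta>"
  then have "max (- \<beta>) (min \<beta> \<theta>) = \<theta>" "\<theta> \<in> {-\<beta>..\<beta>}" by auto
  then obtain x where "\<theta> = \<Theta> x" unfolding \<Theta>_image[symmetric] by auto
  with \<open>max (- \<beta>) (min \<beta> \<theta>) = \<theta>\<close> show ?thesis by (simp add: \<eta>_def inv_\<Theta>)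
qed

lemma \<eta>_outside: "\<beta> \<le> \<theta> \<Longrightarrow> \<eta> \<theta> = pi" "\<theta> \<le> - \<beta> \<Longrightarrow> \<eta> \<theta> = - pi"
proof -
  assume "\<beta> \<le> \<theta>"
  then have "max (- \<beta>) (min \<beta> \<theta>) = \<Theta> pi" using \<beta>_bounds \<Theta>_pi by auto
  then show "\<eta> \<theta> = pi" by (simp add: \<eta>_def inv_\<Theta>)
next
  assume "\<theta> \<le> - \<beta>"
  then have "max (- \<beta>) (min \<beta> \<theta>) = \<Theta> (- pi)" using \<beta>_bounds \<Theta>_pi \<Theta>_minus[of pi] by auto
  then show "\<eta> \<theta> = - pi" by (simp add: \<eta>_def inv_\<Theta>)
qed

lemma \<eta>_bound: "\<bar>\<theta>\<bar> < \<beta> \<Longrightarrow> \<bar>\<eta> \<theta>\<bar> < pi"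
proof -
  assume "\<bar>\<theta>\<bar> < \<beta>"
  then have "\<Theta> (\<eta> \<theta>) < \<Theta> pi" "\<Theta> (- pi) < \<Theta> (\<eta> \<theta>)"
    using \<eta>_inside[of \<theta>] by (simp_all only: \<Theta>_pi \<Theta>_minus)
  then show ?thesis
    by (simp add: \<Theta>_strict_mono abs_less_iff)
qed

lemma \<eta>_minus: "\<eta> (- \<theta>) = - \<eta> \<theta>"
proof (cases "\<bar>\<theta>\<bar> \<le> \<beta>")
  case True
  then have "\<Theta> (\<eta> (- \<theta>)) = \<Theta> (- \<eta> \<theta>)" by (simp add: \<eta>_inside \<Theta>_minus)
  then show ?thesis using inj_\<Theta> by (simp add: inj_eq)
next
  case False
  then consider "\<theta> \<ge> \<beta>" | "\<theta> \<le> - \<beta>" by linarith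
  then show ?thesis by cases (simp_all add: \<eta>_outside)
qed

lemma continuous_on_\<eta> [continuous_intros]:
  assumes "continuous_on S f"
  shows "continuous_on S (\<lambda>x. \<eta> (f x))"
proof -
  have 1: "continuous_on {-\<beta>..\<beta>} (inv \<Theta>)"
    unfolding \<Theta>_image[symmetric]
    by (rule continuous_on_inv) (auto simp: inv_\<Theta> continuous_on_\<Theta>)
  show ?thesis
    unfolding \<eta>_def
    by (rule continuous_on_compose2[OF 1]) (use \<beta>_bounds in \<open>auto intro!: continuous_intros assms\<close>)
qed

lemma \<eta>_deriv:
  assumes "\<bar>\<theta>\<bar> < \<beta>"
  shows "(\<eta> has_real_derivative w (\<eta> \<theta>) / v (\<eta> \<theta>)) (at \<theta>)"
proof -
  have "isCont \<eta> \<theta>"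
    using continuous_on_\<eta>[of UNIV "\<lambda>x. x"] by (simp add: continuous_on_eq_continuous_at)
  then have "(\<eta> has_real_derivative inverse (v (\<eta> \<theta>) / w (\<eta> \<theta>))) (at \<theta>)"
    using assms v_pos w_pos
    by (intro DERIV_inverse_function[where a="-\<beta>" and b=\<beta>, OF \<Theta>_deriv])
      (auto intro!: \<eta>_inside simp: less_imp_neq[symmetric] abs_le_iff)
  then show ?thesis by simp
qed

text \<open>
  \<open>f\<close> is the profile of the solution, \<open>f'\<close> its derivative, \<open>Q\<close> the length of the gradient on the unit
  circle; \<open>A\<close> and \<open>B\<close> are the radial and angular components of the flux there.
\<close>

definition f :: "real \<Rightarrow> real" where "f \<theta> = cos (\<eta> \<theta>) * sqrt (w (\<eta> \<theta>))"

definition f' :: "real \<Rightarrow> real" where "f' \<theta> = - 2 * sin (\<eta> \<theta>) * sqrt (w (\<eta> \<theta>))"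

definition Q :: "real \<Rightarrow> real" where "Q \<theta> = 2 * sqrt (w (\<eta> \<theta>))"

definition A :: "real \<Rightarrow> real" where "A \<theta> = Q \<theta> powr (p - 1) * cos (\<eta> \<theta>)"

definition B :: "real \<Rightarrow> real" where "B \<theta> = - (Q \<theta> powr (p - 1) * sin (\<eta> \<theta>))"

definition B' :: "real \<Rightarrow> real" where "B' \<theta> = (if \<bar>\<theta>\<bar> < \<beta> then - p * A \<theta> else 0)"

lemma Q_pos: "0 < Q \<theta>" by (simp add: Q_def w_pos)

lemma f_eq_Q: "2 * f \<theta> = Q \<theta> * cos (\<eta> \<theta>)" "f' \<theta> = - (Q \<theta> * sin (\<eta> \<theta>))"
  by (simp_all add: f_def f'_def Q_def)

lemma continuous_on_w [continuous_intros]: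
  fixes g :: "'a::t2_space \<Rightarrow> real"
  shows "continuous_on S g \<Longrightarrow> continuous_on S (\<lambda>x. w (g x))"
  unfolding w_def by (intro continuous_intros)

lemma continuous_on_profile:
  "continuous_on S f" "continuous_on S f'" "continuous_on S Q" "continuous_on S A" "continuous_on S B"
proof -
  show "continuous_on S f" unfolding f_def by (intro continuous_intros)
  show "continuous_on S f'" unfolding f'_def by (intro continuous_intros)
  show Q: "continuous_on S Q" for S unfolding Q_def by (intro continuous_intros)
  have "Q x \<noteq> 0" for x using Q_pos[of x] by simp
  then show "continuous_on S A" "continuous_on S B" unfolding A_def B_def
    by (auto intro!: continuous_intros Q)
qed

lemma outside:
  assumes "\<beta> \<le> \<bar>\<theta>\<bar>"
  shows "cos (\<eta> \<theta>) = -1" "sin (\<eta> \<theta>) = 0" "w (\<eta> \<theta>) = 1" "f \<theta> = -1" "f' \<theta> = 0" "Q \<theta> = 2"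
    "A \<theta> = - (2 powr (p - 1))" "B \<theta> = 0"
proof -
  have "\<eta> \<theta> = pi \<or> \<eta> \<theta> = - pi"
    using assms \<eta>_outside[of \<theta>] by (cases "\<theta> \<ge> 0") auto
  then show "cos (\<eta> \<theta>) = -1" "sin (\<eta> \<theta>) = 0" by auto
  then show "w (\<eta> \<theta>) = 1" "f \<theta> = -1" "f' \<theta> = 0" "Q \<theta> = 2" "A \<theta> = - (2 powr (p - 1))" "B \<theta> = 0"
    by (simp_all add: w_def f_def f'_def Q_def A_def B_def)
qed

lemma f_minus: "f (- \<theta>) = f \<theta>"
  by (simp add: f_def \<eta>_minus w_def)

text \<open>
  Because \<open>f\<^sup>2 = 1 - s\<^sup>2 (1 - k (1 - s\<^sup>2))\<close> with \<open>s = sin \<eta>\<close> and \<open>k < 1\<close>, the profile can reach \<open>-1\<close> only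
  where \<open>s = 0\<close>; inside the sector this leaves \<open>\<eta> = 0\<close>, where \<open>f = 1\<close>.
\<close>

lemma f_gt: 
  assumes "\<bar>\<theta>\<bar> < \<beta>" shows "- 1 < f \<theta>"
proof -
  define s where "s = sin (\<eta> \<theta>)"
  define t where "t = cos (\<eta> \<theta>)"
  have st: "t\<^sup>2 = 1 - s\<^sup>2" unfolding s_def t_def by (simp add: cos_squared_eq)
  have s1: "s\<^sup>2 \<le> 1" unfolding s_def by (rule sin_sq_bounds)
  have f2: "(f \<theta>)\<^sup>2 = 1 - s\<^sup>2 * (1 - k * (1 - s\<^sup>2))"
  proof -
    have "(sqrt (w (\<eta> \<theta>)))\<^sup>2 = 1 + k * s\<^sup>2"
      using w_pos[of "\<eta> \<theta>"] by (simp add: w_def s_def)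
    then show ?thesis
      unfolding f_def power_mult_distrib t_def[symmetric] by (simp add: st algebra_simps)
  qed
  have "k * (1 - s\<^sup>2) < 1"
  proof -
    have "k * (1 - s\<^sup>2) \<le> \<bar>k\<bar> * 1"
      using s1 by (intro order_trans[OF mult_right_mono[of k "\<bar>k\<bar>"] mult_left_mono]) auto
    then show ?thesis using k_bounds by linarith
  qed
  show ?thesis
  proof (cases "s = 0")
    case True
    then have "\<eta> \<theta> = 0"
      using \<eta>_bound[OF assms] sin_eq_0_pi[of "\<eta> \<theta>"] by (simp add: s_def abs_less_iff)
    then show ?thesis by (simp add: f_def w_def)
  next
    case False
    then have "(f \<theta>)\<^sup>2 < 1"
      using \<open>k * (1 - s\<^sup>2) < 1\<close> unfolding f2 by simp
    then show ?thesis
      by (simp add: abs_square_less_1 abs_less_iff)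
  qed
qed

lemma f_gt_iff: "- 1 < f \<theta> \<longleftrightarrow> \<bar>\<theta>\<bar> < \<beta>"
  using f_gt[of \<theta>] outside(4)[of \<theta>] by (cases "\<bar>\<theta>\<bar> < \<beta>") auto

lemma f_ge: "- 1 \<le> f \<theta>"
  using f_gt[of \<theta>] outside(4)[of \<theta>] by (cases "\<bar>\<theta>\<bar> < \<beta>") auto

lemma deriv_outside:
  assumes "\<beta> < \<bar>\<theta>\<bar>" and "\<And>x. \<beta> \<le> \<bar>x\<bar> \<Longrightarrow> g x = (C::real)"
  shows "(g has_real_derivative 0) (at \<theta>)"
proof (rule has_field_derivative_transform_within_open[where S = "{x. \<beta> < \<bar>x\<bar>}" and f = "\<lambda>_. C"])
  show "open {x::real. \<beta> < \<bar>x\<bar>}" by (intro open_Collect_less continuous_intros)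
qed (use assms in auto)

lemma w_\<eta>_deriv:
  assumes "\<bar>\<theta>\<bar> < \<beta>"
  shows "((\<lambda>\<theta>. w (\<eta> \<theta>)) has_real_derivative
    2 * k * sin (\<eta> \<theta>) * cos (\<eta> \<theta>) * (w (\<eta> \<theta>) / v (\<eta> \<theta>))) (at \<theta>)"
  unfolding w_def by (auto intro!: derivative_eq_intros \<eta>_deriv assms simp: w_def)

text \<open>
  Differentiating \<open>cos \<eta> sqrt w\<close> by the phase equation \<open>\<eta>' = w / v\<close> produces a factor \<open>-2 v sin \<eta>\<close> that
  cancels the denominator \<open>v\<close>.
\<close>

lemma f_deriv:
  assumes "\<theta> \<notin> {-\<beta>, \<beta>}"
  shows "(f has_real_derivative f' \<theta>) (at \<theta>)"
proof (cases "\<bar>\<theta>\<bar> < \<beta>")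
  case False
  with assms have "\<beta> < \<bar>\<theta>\<bar>" by (auto simp: abs_if split: if_splits)
  then show ?thesis
    using deriv_outside[of \<theta> f "-1"] outside(4) outside(5)[of \<theta>] by simp
next
  case True
  define s where "s = sin (\<eta> \<theta>)"
  define t where "t = cos (\<eta> \<theta>)"
  define W where "W = sqrt (w (\<eta> \<theta>))"
  have W: "W > 0" "W\<^sup>2 = w (\<eta> \<theta>)" using w_pos[of "\<eta> \<theta>"] by (simp_all add: W_def)
  have t2: "t\<^sup>2 = 1 - s\<^sup>2" unfolding s_def t_def by (simp add: cos_squared_eq)
  have v: "v (\<eta> \<theta>) = (1 - k) / 2 + k * s\<^sup>2" unfolding v_def k_eq(2) s_def ..
  have w: "w (\<eta> \<theta>) = 1 + k * s\<^sup>2" unfolding w_def s_def ..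
  let ?d = "w (\<eta> \<theta>) / v (\<eta> \<theta>)"
  have dc: "((\<lambda>\<theta>. cos (\<eta> \<theta>)) has_real_derivative - s * ?d) (at \<theta>)"
    unfolding s_def by (auto intro!: derivative_eq_intros \<eta>_deriv True)
  have dW: "((\<lambda>\<theta>. sqrt (w (\<eta> \<theta>))) has_real_derivative inverse W / 2 * (2 * k * s * t * ?d)) (at \<theta>)"
    unfolding W_def s_def t_def using w_pos[of "\<eta> \<theta>"]
    by (intro DERIV_chain2[OF DERIV_real_sqrt w_\<eta>_deriv[OF True]])
  have "(f has_real_derivative (- s * ?d) * W + inverse W / 2 * (2 * k * s * t * ?d) * t) (at \<theta>)"
    unfolding f_def W_def t_def by (rule DERIV_mult[OF dc dW[unfolded W_def t_def]])
  moreover have "(- s * ?d) * W + inverse W / 2 * (2 * k * s * t * ?d) * t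
      = (- s * W + t * (inverse W / 2 * (2 * k * s * t))) * ?d"
    by (simp add: algebra_simps)
  moreover have "(- s * W + t * (inverse W / 2 * (2 * k * s * t))) * (w (\<eta> \<theta>) / v (\<eta> \<theta>)) = - 2 * s * W"
  proof -
    have "(- s * W + t * (inverse W / 2 * (2 * k * s * t))) * w (\<eta> \<theta>) =
        (- s * W\<^sup>2 + k * s * t\<^sup>2) * W"
      using W(1) unfolding W(2)[symmetric] by (simp add: field_simps power2_eq_square)
    also have "- s * W\<^sup>2 + k * s * t\<^sup>2 = - 2 * s * v (\<eta> \<theta>)"
      unfolding W(2) t2 w v by (simp add: algebra_simps)
    finally show ?thesis
      using v_pos[of "\<eta> \<theta>"] by (simp add: field_simps)
  qed
  ultimately show ?thesis
    by (simp add: f'_def s_def W_def)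
qed

text \<open>
  The \<open>p\<close>-Laplace equation for the profile in divergence form, \<open>B' + p A = 0\<close> in the sector.
\<close>

lemma B_deriv:
  assumes "\<theta> \<notin> {-\<beta>, \<beta>}"
  shows "(B has_real_derivative B' \<theta>) (at \<theta>)"
proof (cases "\<bar>\<theta>\<bar> < \<beta>")
  case False
  with assms have "\<beta> < \<bar>\<theta>\<bar>" by (auto simp: abs_if split: if_splits)
  then show ?thesis
    using deriv_outside[of \<theta> B 0] outside(8) False by (simp add: B'_def)
next
  case True
  define s where "s = sin (\<eta> \<theta>)"
  define t where "t = cos (\<eta> \<theta>)"
  define W where "W = sqrt (w (\<eta> \<theta>))"
  have W: "W > 0" "W\<^sup>2 = w (\<eta> \<theta>)" using w_pos[of "\<eta> \<theta>"] by (simp_all add: W_def)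
  have t2: "t\<^sup>2 = 1 - s\<^sup>2" unfolding s_def t_def by (simp add: cos_squared_eq)
  have v: "v (\<eta> \<theta>) = 1 / p + k * s\<^sup>2" unfolding v_def s_def ..
  have w: "w (\<eta> \<theta>) = 1 + k * s\<^sup>2" unfolding w_def s_def ..
  let ?d = "w (\<eta> \<theta>) / v (\<eta> \<theta>)"
  have dw: "((\<lambda>\<theta>. w (\<eta> \<theta>)) has_real_derivative 2 * k * s * t * ?d) (at \<theta>)"
    unfolding s_def t_def by (rule w_\<eta>_deriv[OF True])
  have dQ: "(Q has_real_derivative 2 * (inverse W / 2 * (2 * k * s * t * ?d))) (at \<theta>)"
    unfolding Q_def W_def using w_pos[of "\<eta> \<theta>"]
    by (intro DERIV_cmult DERIV_chain2[OF DERIV_real_sqrt dw])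
  have ds: "((\<lambda>\<theta>. sin (\<eta> \<theta>)) has_real_derivative t * ?d) (at \<theta>)"
    unfolding t_def by (auto intro!: derivative_eq_intros \<eta>_deriv True)
  have dP: "((\<lambda>\<theta>. Q \<theta> powr (p - 1)) has_real_derivative
      (p - 1) * Q \<theta> powr (p - 1 - 1) * (2 * (inverse W / 2 * (2 * k * s * t * ?d)))) (at \<theta>)"
    using DERIV_fun_powr[OF dQ Q_pos, of "p - 1"] by simp
  have QW: "Q \<theta> = 2 * W" by (simp add: Q_def W_def)
  have Qp: "Q \<theta> powr (p - 1 - 1) = Q \<theta> powr (p - 1) / (2 * W)"
    using powr_diff[of "Q \<theta>" "p - 1" 1] Q_pos[of \<theta>] QW by simp
  have "(B has_real_derivative - ((p - 1) * Q \<theta> powr (p - 1 - 1) * (2 * (inverse W / 2 * (2 * k * s * t * ?d))) * s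
      + t * ?d * Q \<theta> powr (p - 1))) (at \<theta>)"
    unfolding B_def s_def by (rule DERIV_minus[OF DERIV_mult[OF dP ds, unfolded s_def]])
  moreover have "- ((p - 1) * Q \<theta> powr (p - 1 - 1) * (2 * (inverse W / 2 * (2 * k * s * t * ?d))) * s
      + t * ?d * Q \<theta> powr (p - 1)) = - p * (Q \<theta> powr (p - 1) * t)"
  proof -
    have "(p - 1) * Q \<theta> powr (p - 1 - 1) * (2 * (inverse W / 2 * (2 * k * s * t * ?d))) * s
      + t * ?d * Q \<theta> powr (p - 1) = Q \<theta> powr (p - 1) * t * (((p - 1) * k * s\<^sup>2 + W\<^sup>2) / v (\<eta> \<theta>))"
      unfolding Qp W(2)[symmetric] using W(1) v_pos[of "\<eta> \<theta>"] by (simp add: field_simps power2_eq_square)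
    also have "(p - 1) * k * s\<^sup>2 + W\<^sup>2 = p * v (\<eta> \<theta>)"
      unfolding W(2) w v using p_gt_1 by (simp add: field_simps)
    finally show ?thesis using v_pos[of "\<eta> \<theta>"] by simp
  qed
  ultimately show ?thesis
    using True by (simp add: B'_def A_def t_def)
qed

lemma Q_le: "Q \<theta> \<le> 4"
proof -
  have "k * (sin (\<eta> \<theta>))\<^sup>2 \<le> 1 * (sin (\<eta> \<theta>))\<^sup>2"
    using k_bounds by (intro mult_right_mono) auto
  then have "w (\<eta> \<theta>) \<le> 4"
    using sin_sq_bounds[of "\<eta> \<theta>"] unfolding w_def by linarith
  then have "sqrt (w (\<eta> \<theta>)) \<le> sqrt 4" by (rule real_sqrt_le_mono)
  then show ?thesis by (simp add: Q_def)
qed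

lemma A_bounded: "\<bar>A \<theta>\<bar> \<le> 4 powr (p - 1)"
proof -
  have 1: "Q \<theta> powr (p - 1) \<le> 4 powr (p - 1)"
    using p_gt_1 Q_pos[of \<theta>] Q_le[of \<theta>] by (intro powr_mono2) auto
  have "Q \<theta> powr (p - 1) * \<bar>cos (\<eta> \<theta>)\<bar> \<le> Q \<theta> powr (p - 1) * 1"
    by (intro mult_left_mono) auto
  with 1 show ?thesis by (simp add: A_def abs_mult)
qed

lemma borel_measurable_profile [measurable]:
  "f \<in> borel_measurable borel" "f' \<in> borel_measurable borel" "A \<in> borel_measurable borel"
  "B' \<in> borel_measurable borel"
proof -
  show "f \<in> borel_measurable borel" "f' \<in> borel_measurable borel"
    by (intro borel_measurable_continuous_onI continuous_on_profile)+
  show [measurable]: "A \<in> borel_measurable borel"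
    by (intro borel_measurable_continuous_onI continuous_on_profile)
  show "B' \<in> borel_measurable borel" unfolding B'_def by measurable
qed

end

section \<open>Local boundedness, weak gradients and the energy form\<close>

text \<open>
  All functions in question are Borel measurable and bounded on compact sets, which settles every
  integrability condition in the definition of the Sobolev space.
\<close>

definition locally_bounded :: "('a::euclidean_space \<Rightarrow> 'b::real_normed_vector) \<Rightarrow> bool" where
  "locally_bounded f \<longleftrightarrow> (\<forall>K. compact K \<longrightarrow> (\<exists>C. \<forall>x\<in>K. norm (f x) \<le> C))"

lemma Lp_locI:
  assumes [measurable]: "f \<in> borel_measurable borel" and "locally_bounded f" "open \<Omega>" "0 \<le> q"
  shows "f \<in> Lp_loc q \<Omega>"
  unfolding Lp_loc_def
proof (intro CollectI conjI allI impI)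
  have [measurable]: "\<Omega> \<in> sets borel" using \<open>open \<Omega>\<close> by simp
  have "(\<lambda>x. indicator \<Omega> x *\<^sub>R f x) \<in> borel_measurable lborel" by measurable
  then show "set_borel_measurable lebesgue \<Omega> f"
    unfolding set_borel_measurable_def by (rule measurable_completion)
  fix K :: "'a set" assume "compact K" "K \<subseteq> \<Omega>"
  then obtain C where C: "\<And>x. x \<in> K \<Longrightarrow> norm (f x) \<le> C"
    using assms(2) unfolding locally_bounded_def by metis
  have [measurable]: "K \<in> sets borel" using \<open>compact K\<close> by (simp add: borel_closed compact_imp_closed)
  have "integrable lborel (\<lambda>x. indicator K x *\<^sub>R (norm (f x) powr q))"
    by (rule integrableI_bounded_set_indicator[where B = "C powr q"])
      (use \<open>0 \<le> q\<close> \<open>compact K\<close> in \<open>auto intro!: powr_mono2 C emeasure_compact_finite[unfolded infinity_ennreal_def]\<close>)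
  then show "set_integrable lebesgue K (\<lambda>x. norm (f x) powr q)"
    unfolding set_integrable_def by (subst integrable_completion) measurable
qed

lemma integrable_compact_support:
  fixes F :: "'a::euclidean_space \<Rightarrow> 'b::{banach, second_countable_topology}"
  assumes "F \<in> borel_measurable borel" "locally_bounded F" "compact K" "\<And>x. x \<notin> K \<Longrightarrow> F x = 0"
  shows "integrable lborel F"
proof -
  obtain C where C: "\<And>x. x \<in> K \<Longrightarrow> norm (F x) \<le> C"
    using assms(2,3) unfolding locally_bounded_def by metis
  show ?thesis
    by (rule integrableI_bounded_set[where A = K and B = C])
      (use assms C in \<open>auto simp: compact_imp_closed intro: emeasure_compact_finite[unfolded infinity_ennreal_def]\<close>)
qed

lemma locally_bounded_continuous:
  "continuous_on UNIV f \<Longrightarrow> locally_bounded f"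
  unfolding locally_bounded_def
proof (intro allI impI)
  fix K :: "'a set" assume "continuous_on UNIV f" "compact K"
  then have "bounded (f ` K)"
    by (meson compact_continuous_image compact_imp_bounded continuous_on_subset subset_UNIV)
  then show "\<exists>C. \<forall>x\<in>K. norm (f x) \<le> C"
    by (auto simp: bounded_iff)
qed

lemma locally_bounded_mult:
  assumes f: "locally_bounded f" and g: "locally_bounded g"
    and h: "\<And>x. norm (h x) \<le> norm (f x) * norm (g x)"
  shows "locally_bounded h"
  unfolding locally_bounded_def
proof (intro allI impI)
  fix K :: "'a set" assume K: "compact K"
  obtain C where C: "\<And>x. x \<in> K \<Longrightarrow> norm (f x) \<le> C"
    using f K unfolding locally_bounded_def by metis
  obtain C' where C': "\<And>x. x \<in> K \<Longrightarrow> norm (g x) \<le> C'"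
    using g K unfolding locally_bounded_def by metis
  have "norm (h x) \<le> C * C'" if "x \<in> K" for x
    using C[OF that] C'[OF that] h[of x]
    by (meson mult_mono norm_ge_zero order_trans)
  then show "\<exists>C. \<forall>x\<in>K. norm (h x) \<le> C" by blast
qed

lemma set_LINT_eq_lborel:
  fixes F :: "'a::euclidean_space \<Rightarrow> 'b::{banach, second_countable_topology}"
  assumes "F \<in> borel_measurable borel" "\<And>x. x \<notin> \<Omega> \<Longrightarrow> F x = 0"
  shows "(LINT x:\<Omega>|lebesgue. F x) = (LINT x|lborel. F x)"
proof -
  have "indicator \<Omega> x *\<^sub>R F x = F x" for x
    using assms(2) by (auto simp: indicator_def)
  then show ?thesis
    using assms(1) by (simp add: set_lebesgue_integral_def integral_completion)
qed

text \<open>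
  Integration by parts on the whole space, tested in every direction \<open>e\<close>, passes to any open subset, because
  both integrands vanish outside the support of the test function.
\<close>

lemma W1p_loc_gradI:
  fixes u :: "'a::euclidean_space \<Rightarrow> real"
  assumes q: "0 \<le> q" and \<Omega>: "open \<Omega>"
    and u: "u \<in> borel_measurable borel" "locally_bounded u"
    and g: "g \<in> borel_measurable borel" "locally_bounded g"
    and parts: "\<And>\<zeta> e. \<zeta> \<in> C1c UNIV \<Longrightarrow>
      (LINT x|lborel. (u x *\<^sub>R e) \<bullet> grad \<zeta> x) = - (LINT x|lborel. \<zeta> x * (e \<bullet> g x))"
  shows "W1p_loc_grad q \<Omega> u g"
  unfolding W1p_loc_grad_def is_weak_grad_def
proof (intro conjI ballI)
  show "u \<in> Lp_loc q \<Omega>" "g \<in> Lp_loc q \<Omega>" "u \<in> Lp_loc 1 \<Omega>" "g \<in> Lp_loc 1 \<Omega>"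
    using q \<Omega> u g by (auto intro: Lp_locI)
  fix \<zeta> assume \<zeta>: "\<zeta> \<in> C1c \<Omega>"
  note [measurable] = C1c_measurable[OF \<zeta>] u(1) g(1)
  obtain K where K: "compact K" "K \<subseteq> \<Omega>" "\<And>x. x \<notin> K \<Longrightarrow> \<zeta> x = 0" "\<And>x. x \<notin> K \<Longrightarrow> grad \<zeta> x = 0"
    using C1c_supportE[OF \<zeta>] by metis
  have b: "locally_bounded \<zeta>" "locally_bounded (grad \<zeta>)"
    by (intro locally_bounded_continuous C1c_continuous[OF \<zeta>])+
  have 1: "integrable lborel (\<lambda>x. u x *\<^sub>R grad \<zeta> x)"
    by (rule integrable_compact_support[OF _ _ K(1)])
      (auto simp: K(4) intro: locally_bounded_mult[OF u(2) b(2)])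
  have 2: "integrable lborel (\<lambda>x. \<zeta> x *\<^sub>R g x)"
    by (rule integrable_compact_support[OF _ _ K(1)])
      (auto simp: K(3) intro: locally_bounded_mult[OF b(1) g(2)])
  have "(LINT x|lborel. u x *\<^sub>R grad \<zeta> x) = - (LINT x|lborel. \<zeta> x *\<^sub>R g x)"
  proof (rule euclidean_eqI)
    fix e :: 'a
    have "(LINT x|lborel. u x *\<^sub>R grad \<zeta> x) \<bullet> e = (LINT x|lborel. (u x *\<^sub>R e) \<bullet> grad \<zeta> x)"
      by (subst integral_inner_left[symmetric]) (use 1 in \<open>auto simp: inner_commute\<close>)
    also have "\<dots> = - (LINT x|lborel. \<zeta> x * (e \<bullet> g x))"
      using \<zeta> by (intro parts) (auto intro: C1c_mono)
    also have "(LINT x|lborel. \<zeta> x * (e \<bullet> g x)) = (LINT x|lborel. \<zeta> x *\<^sub>R g x) \<bullet> e"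
      by (subst integral_inner_left[symmetric]) (use 2 in \<open>auto simp: inner_commute\<close>)
    finally show "(LINT x|lborel. u x *\<^sub>R grad \<zeta> x) \<bullet> e = (- (LINT x|lborel. \<zeta> x *\<^sub>R g x)) \<bullet> e"
      by simp
  qed
  moreover have "(LINT x:\<Omega>|lebesgue. u x *\<^sub>R grad \<zeta> x) = (LINT x|lborel. u x *\<^sub>R grad \<zeta> x)"
    by (rule set_LINT_eq_lborel) (use K in auto)
  moreover have "(LINT x:\<Omega>|lebesgue. \<zeta> x *\<^sub>R g x) = (LINT x|lborel. \<zeta> x *\<^sub>R g x)"
    by (rule set_LINT_eq_lborel) (use K in auto)
  ultimately show "(LINT x:\<Omega>|lebesgue. u x *\<^sub>R grad \<zeta> x) = - (LINT x:\<Omega>|lebesgue. \<zeta> x *\<^sub>R g x)"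
    by simp
qed

lemma p_energy_form_eq:
  assumes "\<zeta> \<in> C1c \<Omega>" and [measurable]: "g \<in> borel_measurable borel"
  shows "p_energy_form p \<Omega> g \<zeta> = (LINT x|lborel. ((norm (g x) powr (p - 2)) *\<^sub>R g x) \<bullet> grad \<zeta> x)"
proof -
  note [measurable] = C1c_measurable[OF assms(1)]
  obtain K where K: "K \<subseteq> \<Omega>" "\<And>x. x \<notin> K \<Longrightarrow> grad \<zeta> x = 0"
    using C1c_supportE[OF assms(1)] by metis
  have "grad \<zeta> x = 0" if "x \<notin> \<Omega>" for x using K that by blast
  then show ?thesis unfolding p_energy_form_def
    by (intro set_LINT_eq_lborel) auto
qed

section \<open>The polar angle as a function on the plane\<close>

definition angle :: "real^2 \<Rightarrow> real" where "angle x = arccos (x $ 1 / norm x)"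

lemma cos_quotient_bounds:
  "\<bar>x $ 1 / norm (x::real^2)\<bar> \<le> 1" "- 1 \<le> x $ 1 / norm x" "x $ 1 / norm x \<le> 1"
proof -
  show "\<bar>x $ 1 / norm (x::real^2)\<bar> \<le> 1"
    using component_le_norm_cart[of x 1] by (cases "x = 0") (auto simp: divide_le_eq abs_divide)
  then show "- 1 \<le> x $ 1 / norm x" "x $ 1 / norm x \<le> 1" by linarith+
qed

lemma angle_bounds: "0 \<le> angle x" "angle x \<le> pi"
  unfolding angle_def by (intro arccos_lbound arccos_ubound cos_quotient_bounds)+

lemma cos_angle: "cos (angle x) = x $ 1 / norm x"
  unfolding angle_def by (intro cos_arccos_abs cos_quotient_bounds)

lemma angle_polar: "0 < r \<Longrightarrow> \<bar>\<theta>\<bar> \<le> pi \<Longrightarrow> angle (polar r \<theta>) = \<bar>\<theta>\<bar>"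
  by (simp add: angle_def arccos_cos_eq_abs)

text \<open>
  \<open>arccos\<close> is unspecified outside \<open>[-1, 1]\<close>; clamping its argument makes it continuous on the real line.
\<close>

lemma measurable_angle [measurable]: "angle \<in> borel_measurable borel"
proof -
  have [measurable]: "(\<lambda>y::real. arccos (max (-1) (min 1 y))) \<in> borel_measurable borel"
    by (intro borel_measurable_continuous_onI continuous_on_arccos continuous_intros) auto
  have "angle x = arccos (max (-1) (min 1 (x $ 1 / norm x)))" for x
    using cos_quotient_bounds[of x] by (simp add: angle_def)
  then have "angle = (\<lambda>x. (\<lambda>y. arccos (max (-1) (min 1 y))) (x $ 1 / norm x))" by (rule ext)
  also have "\<dots> \<in> borel_measurable borel" by measurable
  finally show ?thesis .
qed

lemma continuous_on_angle: "continuous_on (- {0}) angle"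
  unfolding angle_def
  by (intro continuous_on_arccos continuous_intros ballI conjI cos_quotient_bounds) auto

text \<open>
  On the negative horizontal axis this value is \<open>0\<close> rather than \<open>\<plusminus>pi\<close>. The signed angle only enters
  the weak gradient, which is determined up to null sets, whereas the solution itself is even in the angle
  and is defined by means of \<open>angle\<close>.
\<close>

definition signed_angle :: "real^2 \<Rightarrow> real" where "signed_angle x = sgn (x $ 2) * angle x"

lemma signed_angle_polar:
  assumes "0 < r" "-pi < \<theta>" "\<theta> < pi"
  shows "signed_angle (polar r \<theta>) = \<theta>"
proof -
  have "sgn (r * sin \<theta>) = sgn \<theta>"
    using assms sin_gt_zero[of \<theta>] sin_gt_zero[of "- \<theta>"]
    by (cases "\<theta> > 0"; cases "\<theta> = 0") (auto simp: sgn_if mult_less_0_iff zero_less_mult_iff not_less)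
  then show ?thesis
    using assms by (simp add: signed_angle_def angle_polar abs_if sgn_if)
qed

lemma measurable_signed_angle [measurable]: "signed_angle \<in> borel_measurable borel"
  unfolding signed_angle_def by measurable

section \<open>The homogeneous solution\<close>

context corner_profile
begin

definition u :: "real^2 \<Rightarrow> real" where "u x = (norm x)\<^sup>2 * f (angle x)"

definition g :: "real^2 \<Rightarrow> real^2" where
  "g x = (2 * f (angle x)) *\<^sub>R x + f' (signed_angle x) *\<^sub>R vector [- x $ 2, x $ 1]"

lemma f_abs: "f \<bar>\<theta>\<bar> = f \<theta>"
  by (simp add: abs_if f_minus)

lemma u_polar: "0 < r \<Longrightarrow> \<bar>\<theta>\<bar> \<le> pi \<Longrightarrow> u (polar r \<theta>) = r\<^sup>2 * f \<theta>"
  by (simp add: u_def angle_polar f_abs)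

lemma g_polar:
  assumes "0 < r" "-pi < \<theta>" "\<theta> < pi"
  shows "g (polar r \<theta>) = (2 * f \<theta> * r) *\<^sub>R polar 1 \<theta> + (f' \<theta> * r) *\<^sub>R polar 1 (\<theta> + pi/2)"
  using assms
  by (simp add: g_def angle_polar signed_angle_polar f_abs vec_eq_iff forall_2 sin_add cos_add)

text \<open>
  The geometric meaning of the phase: at polar angle \<open>\<theta>\<close> the gradient points in direction \<open>\<theta> - \<eta>\<close>.
\<close>

lemma g_polar_Q:
  assumes "0 < r" "-pi < \<theta>" "\<theta> < pi"
  shows "g (polar r \<theta>) = (r * Q \<theta>) *\<^sub>R polar 1 (\<theta> - \<eta> \<theta>)"
  unfolding g_polar[OF assms] polar_rotate[symmetric] f_eq_Q
  by (simp add: algebra_simps)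

lemma f_bounded: "\<bar>f \<theta>\<bar> \<le> 2" "\<bar>f' \<theta>\<bar> \<le> 4"
proof -
  have "Q \<theta> * \<bar>cos (\<eta> \<theta>)\<bar> \<le> 4 * 1" "Q \<theta> * \<bar>sin (\<eta> \<theta>)\<bar> \<le> 4 * 1"
    using Q_pos[of \<theta>] by (intro mult_mono Q_le; simp)+
  then have "\<bar>2 * f \<theta>\<bar> \<le> 4" "\<bar>f' \<theta>\<bar> \<le> 4"
    unfolding f_eq_Q using Q_pos[of \<theta>] by (simp_all add: abs_mult)
  then show "\<bar>f \<theta>\<bar> \<le> 2" "\<bar>f' \<theta>\<bar> \<le> 4" by auto
qed

lemma measurable_ug [measurable]: "u \<in> borel_measurable borel" "g \<in> borel_measurable borel"
  unfolding u_def g_def vector2_eq by measurable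

lemma u_bound: "\<bar>u x\<bar> \<le> 2 * (norm x)\<^sup>2"
proof -
  have "(norm x)\<^sup>2 * \<bar>f (angle x)\<bar> \<le> (norm x)\<^sup>2 * 2"
    by (intro mult_left_mono f_bounded) simp
  then show ?thesis by (simp add: u_def abs_mult)
qed

lemma g_bound: "norm (g x) \<le> 8 * norm x"
proof -
  have n: "norm (vector [- x $ 2, x $ 1] :: real^2) = norm x"
    by (simp add: norm_vec2 add.commute)
  have "norm (g x) \<le> \<bar>2 * f (angle x)\<bar> * norm x + \<bar>f' (signed_angle x)\<bar> * norm x"
    unfolding g_def by (rule order_trans[OF norm_triangle_ineq]) (simp add: n)
  also have "\<dots> \<le> 4 * norm x + 4 * norm x"
    using f_bounded by (intro add_mono mult_right_mono) (auto simp: abs_mult)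
  finally show ?thesis by simp
qed

lemma locally_bounded_ug: "locally_bounded u" "locally_bounded g"
proof -
  have "locally_bounded (\<lambda>x::real^2. norm x)" "locally_bounded (\<lambda>x::real^2. 2 * norm x)" "locally_bounded (\<lambda>x::real^2. 8::real)"
    by (intro locally_bounded_continuous continuous_intros)+
  then show "locally_bounded u" "locally_bounded g"
    using u_bound g_bound by (auto intro: locally_bounded_mult simp: power2_eq_square mult.assoc)
qed

lemma u_continuous: "continuous_on UNIV u"
proof -
  have "continuous_on (- {0}) u"
    unfolding u_def
    by (intro continuous_intros continuous_on_compose2[OF continuous_on_profile(1)[of UNIV] continuous_on_angle]) auto
  then have "isCont u x" if "x \<noteq> 0" for x
    using that continuous_on_eq_continuous_at[of "- {0}" u] by auto
  moreover have "isCont u 0"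
  proof -
    have "(u \<longlongrightarrow> 0) (at 0)"
    proof (rule Lim_null_comparison)
      show "\<forall>\<^sub>F x in at 0. norm (u x) \<le> 2 * (norm x)\<^sup>2" using u_bound by simp
      show "((\<lambda>x::real^2. 2 * (norm x)\<^sup>2) \<longlongrightarrow> 0) (at 0)"
        by (auto intro!: tendsto_eq_intros)
    qed
    moreover have "u 0 = 0" by (simp add: u_def)
    ultimately show ?thesis by (simp add: isCont_def)
  qed
  ultimately show ?thesis by (metis continuous_at_imp_continuous_on)
qed

lemma u_homogeneous: "two_homogeneous u"
  unfolding two_homogeneous_def u_def angle_def by (auto simp: power_mult_distrib)

definition S :: "(real^2) set" where "S = {x. - (norm x)\<^sup>2 < u x}"

lemma u_ge: "- (norm x)\<^sup>2 \<le> u x"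
  using mult_left_mono[OF f_ge[of "angle x"], of "(norm x)\<^sup>2"] by (simp add: u_def)

text \<open>
  A description of the cone without angles, from which openness and a closed superset of the closure are
  immediate.
\<close>

lemma S_eq: "S = {x. cos \<beta> * norm x < x $ 1}"
proof (intro set_eqI)
  fix x :: "real^2"
  show "x \<in> S \<longleftrightarrow> x \<in> {x. cos \<beta> * norm x < x $ 1}"
  proof (cases "x = 0")
    case False
    then have n: "0 < norm x" by simp
    have "x \<in> S \<longleftrightarrow> (norm x)\<^sup>2 * (- 1) < (norm x)\<^sup>2 * f (angle x)"
      by (simp add: S_def u_def)
    also have "\<dots> \<longleftrightarrow> angle x < \<beta>"
      using n angle_bounds[of x] by (subst mult_less_cancel_left_pos) (auto simp: f_gt_iff)
    also have "\<dots> \<longleftrightarrow> cos \<beta> < cos (angle x)"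
      using \<beta>_bounds angle_bounds[of x] by (subst cos_mono_less_eq) auto
    also have "\<dots> \<longleftrightarrow> cos \<beta> * norm x < x $ 1"
      using n by (simp add: cos_angle pos_less_divide_eq)
    finally show ?thesis by simp
  qed (simp add: S_def u_def)
qed

lemma S_polar: "0 < r \<Longrightarrow> \<bar>\<theta>\<bar> \<le> pi \<Longrightarrow> polar r \<theta> \<in> S \<longleftrightarrow> \<bar>\<theta>\<bar> < \<beta>"
  using mult_less_cancel_left_pos[of "r\<^sup>2" "-1" "f \<theta>"] by (simp add: S_def u_polar f_gt_iff)

lemma open_S: "open S"
  unfolding S_eq by (intro open_Collect_less continuous_intros)

text \<open>
  The left-hand side is the pairing of \<open>grad \<zeta>\<close> with the field \<open>u e\<close>, homogeneous of degree \<open>2\<close>. Its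
  divergence in polar coordinates is \<open>e \<bullet> g\<close>.
\<close>

lemma weak_gradient_u:
  assumes \<zeta>: "\<zeta> \<in> C1c UNIV"
  shows "(LINT x|lborel. (u x *\<^sub>R e) \<bullet> grad \<zeta> x) = - (LINT x|lborel. \<zeta> x * (e \<bullet> g x))"
proof -
  note [measurable] = C1c_measurable[OF \<zeta>]
  obtain K where K: "compact K" "\<And>x. x \<notin> K \<Longrightarrow> \<zeta> x = 0" "\<And>x. x \<notin> K \<Longrightarrow> grad \<zeta> x = 0"
    using C1c_supportE[OF \<zeta>] by metis
  have b: "locally_bounded \<zeta>" "locally_bounded (grad \<zeta>)"
    by (intro locally_bounded_continuous C1c_continuous[OF \<zeta>])+
  have be: "locally_bounded (\<lambda>x. u x *\<^sub>R e)" "locally_bounded (\<lambda>x. e \<bullet> g x)"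
    by (rule locally_bounded_mult[OF locally_bounded_ug(1) locally_bounded_continuous[of "\<lambda>_. e"]];
        auto)
       (rule locally_bounded_mult[OF locally_bounded_continuous[of "\<lambda>_. e"] locally_bounded_ug(2)];
        auto simp: Cauchy_Schwarz_ineq2)
  have 1: "integrable lborel (\<lambda>x. (u x *\<^sub>R e) \<bullet> grad \<zeta> x)"
    by (rule integrable_compact_support[OF _ locally_bounded_mult[OF be(1) b(2) Cauchy_Schwarz_ineq2[THEN order_trans[rotated]]] K(1)])
      (auto simp: K Cauchy_Schwarz_ineq2)
  have 2: "integrable lborel (\<lambda>x. \<zeta> x * (e \<bullet> g x))"
    by (rule integrable_compact_support[OF _ locally_bounded_mult[OF b(1) be(2)] K(1)])
      (auto simp: K abs_mult)
  define A1 where "A1 \<theta> = f \<theta> * (e \<bullet> polar 1 \<theta>)" for \<theta>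
  define B1 where "B1 \<theta> = f \<theta> * (e \<bullet> polar 1 (\<theta> + pi/2))" for \<theta>
  define D1 where "D1 \<theta> = f' \<theta> * (e \<bullet> polar 1 (\<theta> + pi/2)) - f \<theta> * (e \<bullet> polar 1 \<theta>)" for \<theta>
  have "(LINT x|lborel. (u x *\<^sub>R e) \<bullet> grad \<zeta> x) = - (LINT (r, \<theta>)|(lborel \<Otimes>\<^sub>M lborel).
      polar_indicator r \<theta> * (r powr 2 * ((2 + 1) * A1 \<theta> + D1 \<theta>) * \<zeta> (polar r \<theta>)))"
  proof (rule polar_divergence[OF \<zeta> _ _ 1, where X = "{-\<beta>, \<beta>}" and C = "6 * norm e" and B = B1])
    fix r \<theta> :: real assume r: "0 < r" "-pi < \<theta>" "\<theta> < pi"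
    then have "u (polar r \<theta>) *\<^sub>R e = (r powr 2 * f \<theta>) *\<^sub>R e"
      by (simp add: u_polar)
    also have "\<dots> = r powr 2 *\<^sub>R f \<theta> *\<^sub>R ((e \<bullet> polar 1 \<theta>) *\<^sub>R polar 1 \<theta> + (e \<bullet> polar 1 (\<theta> + pi/2)) *\<^sub>R polar 1 (\<theta> + pi/2))"
      using polar_frame[of e \<theta>] by simp
    finally show "u (polar r \<theta>) *\<^sub>R e = r powr 2 *\<^sub>R (A1 \<theta> *\<^sub>R polar 1 \<theta> + B1 \<theta> *\<^sub>R polar 1 (\<theta> + pi/2))"
      by (simp add: A1_def B1_def scaleR_add_right)
  next
    show "continuous_on {-pi..pi} A1" "continuous_on {-pi..pi} B1"
      unfolding A1_def B1_def by (intro continuous_intros continuous_on_profile)+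
    have "f (- pi) = f pi" by (rule f_minus)
    moreover have "polar 1 (- pi + pi/2) = polar 1 (pi + pi/2)"
      using polar_shift_2pi[of 1 "- pi + pi/2"] by (simp add: algebra_simps)
    ultimately show "B1 (-pi) = B1 pi" by (simp add: B1_def)
  next
    fix \<theta> assume "\<theta> \<in> {-pi<..<pi} - {-\<beta>, \<beta>}"
    then have df: "(f has_real_derivative f' \<theta>) (at \<theta>)" by (intro f_deriv) auto
    have "((\<lambda>\<theta>. e \<bullet> polar 1 (\<theta> + pi/2)) has_real_derivative e \<bullet> (- polar 1 \<theta>)) (at \<theta>)"
      unfolding has_real_derivative_iff_has_vector_derivative
      by (rule bounded_linear.has_vector_derivative[OF bounded_linear_inner_right polar_normal_has_vector_derivative])
    from DERIV_mult[OF df this] show "(B1 has_real_derivative D1 \<theta>) (at \<theta>)"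
      unfolding B1_def D1_def by (simp add: algebra_simps)
  next
    show "D1 \<in> borel_measurable borel" unfolding D1_def by measurable
  next
    fix \<theta>
    have "\<bar>e \<bullet> polar 1 t\<bar> \<le> norm e" for t
      using Cauchy_Schwarz_ineq2[of e "polar 1 t"] by simp
    then have "\<bar>f' \<theta>\<bar> * \<bar>e \<bullet> polar 1 (\<theta> + pi/2)\<bar> + \<bar>f \<theta>\<bar> * \<bar>e \<bullet> polar 1 \<theta>\<bar> \<le> 4 * norm e + 2 * norm e"
      by (intro add_mono mult_mono f_bounded) auto
    then show "\<bar>D1 \<theta>\<bar> \<le> 6 * norm e"
      unfolding D1_def by (simp add: abs_mult[symmetric])
  qed auto
  also have "(LINT (r, \<theta>)|(lborel \<Otimes>\<^sub>M lborel).
      polar_indicator r \<theta> * (r powr 2 * ((2 + 1) * A1 \<theta> + D1 \<theta>) * \<zeta> (polar r \<theta>)))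
     = (LINT (r, \<theta>)|(lborel \<Otimes>\<^sub>M lborel). polar_indicator r \<theta> * (r * (\<zeta> (polar r \<theta>) * (e \<bullet> g (polar r \<theta>)))))"
  proof -
    \<comment> \<open>\<open>3 A1 + D1 = 2 f (e \<bullet> polar 1 \<theta>) + f' (e \<bullet> polar 1 (\<theta> + pi/2))\<close>\<close>
    have eq: "polar_indicator r \<theta> * (r powr 2 * ((2 + 1) * A1 \<theta> + D1 \<theta>) * \<zeta> (polar r \<theta>))
      = polar_indicator r \<theta> * (r * (\<zeta> (polar r \<theta>) * (e \<bullet> g (polar r \<theta>))))" for r \<theta>
    proof (cases "0 < r \<and> -pi < \<theta> \<and> \<theta> < pi")
      case True
      then show ?thesis
        by (simp add: g_polar A1_def D1_def inner_add_right power2_eq_square algebra_simps)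
    qed auto
    show ?thesis by (simp only: eq)
  qed
  also have "\<dots> = (LINT x|lborel. \<zeta> x * (e \<bullet> g x))"
    by (rule integral_polar[OF 2])
  finally show ?thesis .
qed

lemma W1p_u: "open \<Omega> \<Longrightarrow> W1p_loc_grad p \<Omega> u g"
  using p_gt_1 by (intro W1p_loc_gradI weak_gradient_u locally_bounded_ug measurable_ug) auto

text \<open>
  The flux is homogeneous of degree \<open>p - 1\<close> with components \<open>A\<close> and \<open>B\<close>.
\<close>

lemma energy_polar:
  assumes \<zeta>: "\<zeta> \<in> C1c \<Omega>"
  shows "p_energy_form p \<Omega> g \<zeta> = - (LINT (r, \<theta>)|(lborel \<Otimes>\<^sub>M lborel).
      polar_indicator r \<theta> * (r powr (p - 1) * (p * A \<theta> + B' \<theta>) * \<zeta> (polar r \<theta>)))"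
proof -
  note [measurable] = C1c_measurable[OF \<zeta>]
  have \<zeta>U: "\<zeta> \<in> C1c UNIV" using \<zeta> by (rule C1c_mono) simp
  obtain K where K: "compact K" "\<And>x. x \<notin> K \<Longrightarrow> grad \<zeta> x = 0"
    using C1c_supportE[OF \<zeta>] by metis
  have b: "locally_bounded (grad \<zeta>)"
    by (intro locally_bounded_continuous C1c_continuous[OF \<zeta>])
  have bV: "locally_bounded (\<lambda>x. norm (g x) powr (p - 2) *\<^sub>R g x)"
    unfolding locally_bounded_def
  proof (intro allI impI)
    fix K :: "(real^2) set" assume "compact K"
    then obtain C where C: "\<And>x. x \<in> K \<Longrightarrow> norm (g x) \<le> C"
      using locally_bounded_ug(2) unfolding locally_bounded_def by metis
    have "norm (norm (g x) powr (p - 2) *\<^sub>R g x) \<le> C powr (p - 1)" if "x \<in> K" for x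
    proof -
      have "norm (norm (g x) powr (p - 2) *\<^sub>R g x) = norm (g x) powr (p - 1)"
        using powr_mult_base[of "norm (g x)" "p - 2"] by (simp add: mult.commute)
      also have "\<dots> \<le> C powr (p - 1)"
        using C[OF that] p_gt_1 by (intro powr_mono2) auto
      finally show ?thesis .
    qed
    then show "\<exists>C. \<forall>x\<in>K. norm (norm (g x) powr (p - 2) *\<^sub>R g x) \<le> C" by blast
  qed
  have int: "integrable lborel (\<lambda>x. (norm (g x) powr (p - 2) *\<^sub>R g x) \<bullet> grad \<zeta> x)"
    by (rule integrable_compact_support[OF _ locally_bounded_mult[OF bV b] K(1)])
      (auto simp: K simp del: inner_scaleR_left norm_scaleR intro: Cauchy_Schwarz_ineq2)
  have "(LINT x|lborel. (norm (g x) powr (p - 2) *\<^sub>R g x) \<bullet> grad \<zeta> x) = - (LINT (r, \<theta>)|(lborel \<Otimes>\<^sub>M lborel).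
      polar_indicator r \<theta> * (r powr (p - 1) * ((p - 1 + 1) * A \<theta> + B' \<theta>) * \<zeta> (polar r \<theta>)))"
  proof (rule polar_divergence[OF \<zeta>U _ _ int, where X = "{-\<beta>, \<beta>}" and C = "p * 4 powr (p - 1)" and B = B])
    show "0 < p - 1" using p_gt_1 by simp
    fix r \<theta> :: real assume r: "0 < r" "-pi < \<theta>" "\<theta> < pi"
    have rQ: "0 < r * Q \<theta>" using r Q_pos[of \<theta>] by simp
    have "norm (g (polar r \<theta>)) powr (p - 2) *\<^sub>R g (polar r \<theta>)
        = ((r * Q \<theta>) powr (p - 2) * (r * Q \<theta>)) *\<^sub>R polar 1 (\<theta> - \<eta> \<theta>)"
      using rQ by (simp add: g_polar_Q[OF r])
    also have "(r * Q \<theta>) powr (p - 2) * (r * Q \<theta>) = r powr (p - 1) * Q \<theta> powr (p - 1)"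
      using powr_mult_base[of "r * Q \<theta>" "p - 2"] rQ r(1) Q_pos[of \<theta>] by (simp add: mult.commute powr_mult)
    finally show "norm (g (polar r \<theta>)) powr (p - 2) *\<^sub>R g (polar r \<theta>)
        = r powr (p - 1) *\<^sub>R (A \<theta> *\<^sub>R polar 1 \<theta> + B \<theta> *\<^sub>R polar 1 (\<theta> + pi/2))"
      unfolding polar_rotate[symmetric] by (simp add: A_def B_def algebra_simps)
  next
    show "continuous_on {-pi..pi} A" "continuous_on {-pi..pi} B" by (intro continuous_on_profile)+
    show "B (-pi) = B pi" using \<beta>_bounds by (simp add: outside)
    show "\<bar>B' \<theta>\<bar> \<le> p * 4 powr (p - 1)" for \<theta>
      using A_bounded[of \<theta>] p_gt_1 by (simp add: B'_def abs_mult)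
  qed (auto intro: B_deriv)
  then show ?thesis
    by (simp add: p_energy_form_eq[OF \<zeta> measurable_ug(2)])
qed

lemma u_superharmonic: "weakly_p_superharmonic p UNIV u"
  unfolding weakly_p_superharmonic_def
proof (intro exI[of _ g] conjI ballI impI W1p_u open_UNIV)
  fix \<zeta> :: "real^2 \<Rightarrow> real" assume \<zeta>: "\<zeta> \<in> C1c UNIV" and pos: "\<forall>x. 0 \<le> \<zeta> x"
  \<comment> \<open>zero in the sector, and \<open>p A < 0\<close> on the contact set\<close>
  have "p * A \<theta> + B' \<theta> \<le> 0" for \<theta>
    using p_gt_1 by (cases "\<bar>\<theta>\<bar> < \<beta>") (auto simp: B'_def outside)
  then have "r powr (p - 1) * (p * A \<theta> + B' \<theta>) * \<zeta> (polar r \<theta>) \<le> 0" for r \<theta>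
    using pos by (intro mult_nonpos_nonneg mult_nonneg_nonpos) auto
  then have nonpos: "polar_indicator r \<theta> * (r powr (p - 1) * (p * A \<theta> + B' \<theta>) * \<zeta> (polar r \<theta>)) \<le> 0" for r \<theta>
    by (rule mult_nonneg_nonpos[rotated]) auto
  have "0 \<le> (LINT z|(lborel \<Otimes>\<^sub>M lborel). - (case z of (r, \<theta>) \<Rightarrow>
      polar_indicator r \<theta> * (r powr (p - 1) * (p * A \<theta> + B' \<theta>) * \<zeta> (polar r \<theta>))))"
    by (intro integral_nonneg_AE AE_I2) (simp only: case_prod_beta neg_0_le_iff_le nonpos)
  then show "0 \<le> p_energy_form p UNIV g \<zeta>"
    unfolding energy_polar[OF \<zeta>] by simp
qed

lemma u_harmonic: "weakly_p_harmonic p S u"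
  unfolding weakly_p_harmonic_def
proof (intro exI[of _ g] conjI ballI W1p_u open_S)
  fix \<zeta> :: "real^2 \<Rightarrow> real" assume \<zeta>: "\<zeta> \<in> C1c S"
  then obtain K where K: "K \<subseteq> S" "\<And>x. x \<notin> K \<Longrightarrow> \<zeta> x = 0"
    using C1c_supportE by metis
  have eq: "polar_indicator r \<theta> * (r powr (p - 1) * (p * A \<theta> + B' \<theta>) * \<zeta> (polar r \<theta>)) = 0" for r \<theta>
  proof (cases "0 < r \<and> -pi < \<theta> \<and> \<theta> < pi \<and> \<beta> \<le> \<bar>\<theta>\<bar>")
    case True
    then have "\<bar>\<theta>\<bar> \<le> pi" by linarith
    with True have "polar r \<theta> \<notin> S" using S_polar[of r \<theta>] by auto
    then show ?thesis using K by auto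
  qed (auto simp: B'_def)
  show "p_energy_form p S g \<zeta> = 0"
    unfolding energy_polar[OF \<zeta>] eq by (simp add: case_prod_unfold)
qed

text \<open>
  The solution is symmetric about the horizontal axis; rotating by \<open>-\<beta>\<close> carries the sector of angles in
  \<open>(0, 2 \<beta>)\<close> to the sector of angles in \<open>(-\<beta>, \<beta>)\<close>.
\<close>

definition rot :: "real^2^2" where
  "rot = vector [vector [cos \<beta>, sin \<beta>], vector [- sin \<beta>, cos \<beta>]]"

lemma rot_nth: "rot $ 1 $ 1 = cos \<beta>" "rot $ 1 $ 2 = sin \<beta>" "rot $ 2 $ 1 = - sin \<beta>" "rot $ 2 $ 2 = cos \<beta>"
  by (simp_all add: rot_def)

lemma rot_polar: "rot *v polar r \<theta> = polar r (\<theta> - \<beta>)"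
  by (simp add: rot_nth vec_eq_iff forall_2 matrix_vector_mult_def sum_2 sin_diff cos_diff algebra_simps)

lemma rotation_rot: "rotation_matrix rot"
proof -
  have 1: "cos \<beta> * cos \<beta> + sin \<beta> * sin \<beta> = 1" "sin \<beta> * sin \<beta> + cos \<beta> * cos \<beta> = 1"
    using sin_cos_squared_add[of \<beta>] by (simp_all add: power2_eq_square)
  have "orthogonal_matrix rot"
    unfolding orthogonal_matrix
    unfolding vec_eq_iff forall_2 matrix_matrix_mult_def transpose_def mat_def sum_2
    by (simp add: rot_nth 1)
  moreover have "det rot = 1"
    by (simp add: rot_nth det_2 1)
  ultimately show ?thesis by (simp add: rotation_matrix_def)
qed

lemma S_eq_polar: "S = {polar r \<theta> | r \<theta>. 0 < r \<and> \<bar>\<theta>\<bar> < \<beta>}"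
proof (intro equalityI subsetI)
  fix x assume x: "x \<in> S"
  obtain \<theta> where \<theta>: "- pi < \<theta>" "\<theta> \<le> pi" "x = polar (norm x) \<theta>" using ex_polar by blast
  have "x \<noteq> 0" using x by (auto simp: S_eq)
  then have "0 < norm x" by simp
  moreover have "\<bar>\<theta>\<bar> < \<beta>"
    using S_polar[of "norm x" \<theta>] \<theta> x \<open>0 < norm x\<close> by (auto simp: abs_le_iff)
  ultimately show "x \<in> {polar r \<theta> | r \<theta>. 0 < r \<and> \<bar>\<theta>\<bar> < \<beta>}" using \<theta>(3) by blast
next
  fix x assume "x \<in> {polar r \<theta> | r \<theta>. 0 < r \<and> \<bar>\<theta>\<bar> < \<beta>}"
  then show "x \<in> S" using S_polar \<beta>_bounds by fastforce
qed

lemma S_eq_rotated_sector: "S = (\<lambda>x. rot *v x) ` sector (2 * \<beta>)"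
proof (intro equalityI subsetI)
  fix x assume "x \<in> S"
  then obtain r \<theta> where x: "x = polar r \<theta>" "0 < r" "\<bar>\<theta>\<bar> < \<beta>" by (auto simp: S_eq_polar)
  then have "polar r (\<theta> + \<beta>) \<in> sector (2 * \<beta>)" by (force simp: sector_def abs_less_iff)
  moreover have "x = rot *v polar r (\<theta> + \<beta>)" by (simp add: rot_polar x)
  ultimately show "x \<in> (\<lambda>x. rot *v x) ` sector (2 * \<beta>)" by blast
next
  fix x assume "x \<in> (\<lambda>x. rot *v x) ` sector (2 * \<beta>)"
  then obtain r \<theta> where "x = polar r (\<theta> - \<beta>)" "0 < r" "0 < \<theta>" "\<theta> < 2 * \<beta>"
    by (auto simp: sector_def rot_polar)
  moreover from this have "\<bar>\<theta> - \<beta>\<bar> < \<beta>" by linarith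
  ultimately show "x \<in> S" unfolding S_eq_polar by blast
qed

lemma frontier_S: "frontier S = {polar r \<theta> | r \<theta>. 0 \<le> r \<and> \<theta> \<in> {-\<beta>, \<beta>}}" (is "_ = ?R")
proof (intro equalityI subsetI)
  fix x assume "x \<in> frontier S"
  then have x: "x \<in> closure S" "x \<notin> S" using open_S by (auto simp: frontier_def interior_open)
  \<comment> \<open>points of the frontier satisfy equality in the description of \<open>S\<close> by an inequality\<close>
  have "closure S \<subseteq> {x. cos \<beta> * norm x \<le> x $ 1}"
    by (intro closure_minimal closed_Collect_le continuous_intros) (auto simp: S_eq)
  with x have eq: "x $ 1 = cos \<beta> * norm x" by (fastforce simp: S_eq)
  obtain \<theta> where \<theta>: "- pi < \<theta>" "\<theta> \<le> pi" "x = polar (norm x) \<theta>" using ex_polar by blast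
  show "x \<in> ?R"
  proof (cases "x = 0")
    case True
    then have "x = polar 0 \<beta>" by (simp add: vec_eq_iff forall_2)
    then show ?thesis by blast
  next
    case False
    have "x $ 1 = norm x * cos \<theta>" using \<theta>(3) polar_nth(1) by metis
    with eq False have "cos \<bar>\<theta>\<bar> = cos \<beta>" by simp
    moreover have "\<bar>\<theta>\<bar> \<le> pi" using \<theta>(1,2) by linarith
    ultimately have "\<bar>\<theta>\<bar> = \<beta>"
      using cos_inj_pi[of "\<bar>\<theta>\<bar>" \<beta>] \<beta>_bounds by simp
    then have "\<theta> \<in> {-\<beta>, \<beta>}" by (cases "0 \<le> \<theta>") simp_all
    then show ?thesis using \<theta>(3) norm_ge_zero[of x] by blast
  qed
next
  fix x assume "x \<in> ?R"
  then obtain r \<theta> where x: "x = polar r \<theta>" "0 \<le> r" "\<theta> \<in> {-\<beta>, \<beta>}" by blast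
  have \<theta>: "\<bar>\<theta>\<bar> = \<beta>" "cos \<theta> = cos \<beta>" using x(3) \<beta>_bounds by auto
  then have "x \<notin> S" using x(2) by (simp add: S_eq x(1))
  moreover have "x \<in> closure S"
    unfolding closure_sequential
  proof (intro exI conjI allI)
    \<comment> \<open>shrink the angle and enlarge the radius, so that the apex is approached as well\<close>
    let ?t = "\<lambda>n. inverse (real (Suc n))"
    let ?s = "\<lambda>n. polar (r + ?t n) (\<theta> * (1 - ?t n))"
    have "polar (r + ?t n) (\<theta> * (1 - ?t n)) \<in> S" for n
    proof -
      have t: "0 < ?t n" "?t n \<le> 1" by (simp_all add: field_simps)
      then have "\<bar>\<theta> * (1 - ?t n)\<bar> = \<beta> * (1 - ?t n)"
        unfolding abs_mult \<theta>(1) by simp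
      also have "\<dots> < \<beta> * 1"
        using t(1) \<beta>_bounds by (intro mult_strict_left_mono) linarith+
      finally have "\<bar>\<theta> * (1 - ?t n)\<bar> < \<beta>" by simp
      moreover have "0 < r + ?t n" using t(1) x(2) by linarith
      ultimately show ?thesis unfolding S_eq_polar by blast
    qed
    then show "?s n \<in> S" for n .
    have t: "?t \<longlonglongrightarrow> 0" by (rule LIMSEQ_inverse_real_of_nat)
    have "?s \<longlonglongrightarrow> polar (r + 0) (\<theta> * (1 - 0))"
      unfolding polar_def vector2_eq by (intro tendsto_intros t)
    then show "?s \<longlonglongrightarrow> x" using x by simp
  qed
  ultimately show "x \<in> frontier S" using open_S by (simp add: frontier_def interior_open)
qed

lemma frontier_S_eq_rotated_rays: "frontier S = (\<lambda>x. rot *v x) ` (ray 0 \<union> ray (2 * \<beta>))"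
proof -
  have "(\<lambda>x. rot *v x) ` ray \<theta> = {polar r (\<theta> - \<beta>) | r. 0 \<le> r}" for \<theta>
    unfolding ray_def by (auto simp: rot_polar image_iff) (metis rot_polar)
  from this[of 0] this[of "2 * \<beta>"] show ?thesis
    unfolding frontier_S image_Un by auto
qed

lemma u_obstacle_solution: "p_obstacle_solution p UNIV (\<lambda>x. - (norm x)\<^sup>2) u"
proof -
  have "u \<in> W1p_loc p UNIV" unfolding W1p_loc_def using W1p_u[OF open_UNIV] by blast
  then show ?thesis
    unfolding p_obstacle_solution_def
    using u_continuous u_ge u_superharmonic u_harmonic open_S by (simp add: S_def)
qed

end

theorem theorem1p1:
  fixes p \<theta>\<^sub>0 :: real and \<phi> :: "real^2 \<Rightarrow> real"
  assumes "p \<in> {1<..<2} \<union> {2<..}"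
    and "\<phi> = (\<lambda>x. - (norm x)\<^sup>2)"
    and "\<theta>\<^sub>0 = 2 * pi * (1 - sqrt ((p - 1) / (2 * p)))"
  shows "\<exists>u :: real^2 \<Rightarrow> real.
      two_homogeneous u \<and>
      p_obstacle_solution p UNIV \<phi> u \<and>
      is_cone_with_angle {x. \<phi> x < u x} \<theta>\<^sub>0 \<and>
      \<theta>\<^sub>0 \<noteq> pi \<and>
      has_corner_at_origin (frontier {x. \<phi> x < u x}) \<theta>\<^sub>0"
proof -
  interpret corner_profile p using assms(1) by unfold_locales auto
  have \<theta>\<^sub>0: "\<theta>\<^sub>0 = 2 * \<beta>" by (simp add: assms(3) \<beta>_def c_def)
  have S: "{x. \<phi> x < u x} = S" by (simp add: S_def assms(2))
  have "c \<noteq> 1 / 2"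
  proof
    assume c: "c = 1 / 2"
    have "(p - 1) / p = 1 / 2" unfolding c_sq[symmetric] c by (simp add: power2_eq_square)
    then show False using assms(1) p_gt_1 by (auto simp: field_simps)
  qed
  then have ne: "\<theta>\<^sub>0 \<noteq> pi" by (simp add: \<theta>\<^sub>0 \<beta>_def)
  have bounds: "0 < \<theta>\<^sub>0" "\<theta>\<^sub>0 < 2 * pi" using \<beta>_bounds by (auto simp: \<theta>\<^sub>0)
  have cone: "is_cone_with_angle S \<theta>\<^sub>0"
    unfolding is_cone_with_angle_def \<theta>\<^sub>0
    by (intro conjI exI[of _ rot] bounds[unfolded \<theta>\<^sub>0] rotation_rot S_eq_rotated_sector)
  have corner: "has_corner_at_origin (frontier S) \<theta>\<^sub>0"
    unfolding has_corner_at_origin_def \<theta>\<^sub>0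
    by (intro conjI exI[of _ rot] bounds[unfolded \<theta>\<^sub>0] ne[unfolded \<theta>\<^sub>0] rotation_rot
        frontier_S_eq_rotated_rays)
  show ?thesis
    by (intro exI[of _ u] conjI)
      (simp_all only: S u_homogeneous ne cone corner, simp_all add: assms(2) u_obstacle_solution)
qed

end
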